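(* With $\gamma_n$ defined as in the context, we have $\gamma_2 = 1$ and $\gamma_3 \ge 2$.
   Context: For an integer $n\ge 1$ and real $H\ge 1$, $\mathcal{M}_n(\mathbb{Z};H)$ is the set of $n\times n$ matrices with integer entries of absolute value at most $H$. For a polynomial $f\in\mathbb{Z}[X]$ (monic of degree $n$), $R_n(H;f)$ is the number of matrices $A\in\mathcal{M}_n(\mathbb{Z};H)$ with characteristic polynomial $\det(XI_n-A)=f(X)$. The number $\gamma_n$ is defined as the largest real number such that, uniformly over polynomials $f$, $R_n(H;f)\le H^{n^2-n-\gamma_n+o(1)}$ as $H\to\infty$. Explicitly, $\gamma_n$ is the largest real $\gamma$ such that for every $\varepsilon>0$ there is $H_0=H_0(n,\varepsilon)$ with $R_n(H;f)\le H^{n^2-n-\gamma+\varepsilon}$ for all $H\ge H_0$ and all monic $f\in\mathbb{Z}[X]$ of degree $n$. *)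

theory Defs
  imports "Jordan_Normal_Form.Char_Poly" "HOL-Library.FuncSet"
begin

definition int_mats :: "nat \<Rightarrow> real \<Rightarrow> int mat set" where
  "int_mats n H = {A \<in> carrier_mat n n. \<forall>i<n. \<forall>j<n. real_of_int \<bar>A $$ (i, j)\<bar> \<le> H}"

definition R_count :: "nat \<Rightarrow> real \<Rightarrow> int poly \<Rightarrow> nat" where
  "R_count n H f = card {A \<in> int_mats n H. char_poly A = f}"

text \<open>The threshold \<open>H0\<close> may depend on \<open>n\<close> and \<open>\<epsilon>\<close> (and on \<open>\<gamma>\<close>), but not on the polynomial \<open>f\<close>.\<close>

definition admissible :: "nat \<Rightarrow> real \<Rightarrow> bool" where
  "admissible n \<gamma> \<longleftrightarrow>
     (\<forall>\<epsilon>>0. \<exists>H0\<ge>1. \<forall>H\<ge>H0. \<forall>f :: int poly. degree f = n \<and> monic f \<longrightarrow>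
        real (R_count n H f) \<le> H powr ((real n)\<^sup>2 - real n - \<gamma> + \<epsilon>))"

definition gamma :: "nat \<Rightarrow> real" where
  "gamma n = (GREATEST \<gamma>. admissible n \<gamma>)"

text \<open>The remaining lemmas show that the sets counted by \<open>R_count\<close> are finite and that the largest
  admissible exponent exists, so that neither \<open>card\<close> nor \<open>GREATEST\<close> takes a default value;
  see \<open>finite_int_mats\<close> and \<open>gamma_greatest\<close>.\<close>

lemma int_mats_bound:
  "finite (int_mats n H) \<and> card (int_mats n H) \<le> (nat (2 * \<lfloor>H\<rfloor> + 1)) ^ (n * n)"
proof -
  let ?I = "{..<n} \<times> {..<n}"
  let ?B = "PiE ?I (\<lambda>_. {- \<lfloor>H\<rfloor>..\<lfloor>H\<rfloor>})"
  let ?g = "\<lambda>A :: int mat. restrict (\<lambda>p. A $$ p) ?I"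
  have fin: "finite ?B" by (intro finite_PiE) auto
  have inj: "inj_on ?g (int_mats n H)"
  proof (rule inj_onI)
    fix A B assume A: "A \<in> int_mats n H" and B: "B \<in> int_mats n H" and eq: "?g A = ?g B"
    have "A $$ (i, j) = B $$ (i, j)" if "i < n" "j < n" for i j
      using fun_cong[OF eq, of "(i, j)"] that by simp
    then show "A = B" using A B by (intro eq_matI) (auto simp: int_mats_def)
  qed
  have sub: "?g ` int_mats n H \<subseteq> ?B"
  proof (intro image_subsetI PiE_I)
    fix A p assume A: "A \<in> int_mats n H" and p: "p \<in> ?I"
    then obtain i j where ij: "p = (i, j)" "i < n" "j < n" by auto
    with A have "real_of_int \<bar>A $$ (i, j)\<bar> \<le> H" by (auto simp: int_mats_def)
    then have "\<bar>A $$ (i, j)\<bar> \<le> \<lfloor>H\<rfloor>" by (simp add: le_floor_iff)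
    then show "?g A p \<in> {- \<lfloor>H\<rfloor>..\<lfloor>H\<rfloor>}" using p ij by auto
  qed auto
  have cardB: "card ?B = (nat (2 * \<lfloor>H\<rfloor> + 1)) ^ (n * n)"
    by (simp add: card_PiE card_cartesian_product)
  show ?thesis
    using inj_on_finite[OF inj sub fin] card_inj_on_le[OF inj sub fin] cardB by simp
qed

lemma finite_int_mats: "finite (int_mats n H)"
  using int_mats_bound by blast

lemma R_count_le:
  assumes "H \<ge> 1"
  shows "real (R_count n H f) \<le> (3 * H) ^ (n * n)"
proof -
  have "R_count n H f \<le> card (int_mats n H)"
    unfolding R_count_def by (intro card_mono finite_int_mats) auto
  also have "\<dots> \<le> (nat (2 * \<lfloor>H\<rfloor> + 1)) ^ (n * n)"
    using int_mats_bound by blast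
  finally have "real (R_count n H f) \<le> real (nat (2 * \<lfloor>H\<rfloor> + 1)) ^ (n * n)"
    by (metis of_nat_le_iff of_nat_power)
  also have "real (nat (2 * \<lfloor>H\<rfloor> + 1)) = 2 * of_int \<lfloor>H\<rfloor> + 1"
    using assms by simp
  also have "(2 * of_int \<lfloor>H\<rfloor> + 1) ^ (n * n) \<le> (3 * H) ^ (n * n)"
  proof (rule power_mono)
    have "of_int \<lfloor>H\<rfloor> \<le> H" by (rule of_int_floor_le)
    then show "2 * of_int \<lfloor>H\<rfloor> + 1 \<le> 3 * H" using assms by linarith
    show "0 \<le> 2 * real_of_int \<lfloor>H\<rfloor> + 1" using assms by simp
  qed
  finally show ?thesis .
qed

lemma admissible_lower: "admissible n (- real n)"
  unfolding admissible_def
proof (intro allI impI)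
  fix \<epsilon> :: real assume e: "\<epsilon> > 0"
  let ?N = "real (n * n)"
  define H0 where "H0 = (3 powr ?N) powr (1 / \<epsilon>)"
  have H01: "H0 \<ge> 1" unfolding H0_def using e by (intro ge_one_powr_ge_zero) auto
  have "real (R_count n H f) \<le> H powr ((real n)\<^sup>2 - real n - - real n + \<epsilon>)"
    if H: "H \<ge> H0" for H and f :: "int poly"
  proof -
    have H1: "H \<ge> 1" using H H01 by linarith
    have "3 powr ?N = H0 powr \<epsilon>" unfolding H0_def using e by (simp add: powr_powr)
    also have "\<dots> \<le> H powr \<epsilon>" using e H H01 by (intro powr_mono2) auto
    finally have le: "3 powr ?N \<le> H powr \<epsilon>" .
    have "real (R_count n H f) \<le> (3 * H) ^ (n * n)" using R_count_le[OF H1] .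
    also have "\<dots> = 3 powr ?N * H powr ?N"
      using H1 by (subst powr_realpow[symmetric]) (auto simp: powr_mult)
    also have "\<dots> \<le> H powr \<epsilon> * H powr ?N" by (rule mult_right_mono[OF le]) simp
    also have "\<dots> = H powr ((real n)\<^sup>2 - real n - - real n + \<epsilon>)"
      by (simp add: powr_add[symmetric] power2_eq_square add.commute)
    finally show ?thesis .
  qed
  then show "\<exists>H0\<ge>1. \<forall>H\<ge>H0. \<forall>f :: int poly. degree f = n \<and> monic f \<longrightarrow>
      real (R_count n H f) \<le> H powr ((real n)\<^sup>2 - real n - - real n + \<epsilon>)"
    using H01 by blast
qed

lemma admissible_upper:
  assumes "admissible n \<gamma>"
  shows "\<gamma> \<le> (real n)\<^sup>2 - real n"
proof (rule ccontr)
  assume neg: "\<not> ?thesis"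
  define \<epsilon> where "\<epsilon> = (\<gamma> - ((real n)\<^sup>2 - real n)) / 2"
  have e: "\<epsilon> > 0" using neg by (simp add: \<epsilon>_def)
  have ex: "(real n)\<^sup>2 - real n - \<gamma> + \<epsilon> = - \<epsilon>" by (simp add: \<epsilon>_def field_simps)
  let ?f = "char_poly (0\<^sub>m n n :: int mat)"
  have f: "degree ?f = n \<and> monic ?f"
    using degree_monic_char_poly[of "0\<^sub>m n n :: int mat" n] by auto
  from assms e obtain H0 where H0: "H0 \<ge> 1"
    "\<forall>H\<ge>H0. \<forall>f :: int poly. degree f = n \<and> monic f \<longrightarrow> real (R_count n H f) \<le> H powr (- \<epsilon>)"
    unfolding admissible_def ex[symmetric] by meson
  define H where "H = H0 + 1"
  have H: "H > 1" "H \<ge> H0" using H0 by (auto simp: H_def)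
  have "0\<^sub>m n n \<in> {A \<in> int_mats n H. char_poly A = ?f}" using H by (auto simp: int_mats_def)
  moreover have "finite {A \<in> int_mats n H. char_poly A = ?f}" using finite_int_mats by simp
  ultimately have "R_count n H ?f > 0" unfolding R_count_def by (auto simp: card_gt_0_iff)
  then have "1 \<le> real (R_count n H ?f)" by simp
  also have "\<dots> \<le> H powr (- \<epsilon>)" using H0 H f by blast
  also have "\<dots> < H powr 0" using H e by (intro powr_less_mono) auto
  finally show False using H by simp
qed

lemma gamma_greatest:
  "admissible n (gamma n) \<and> (\<forall>\<gamma>. admissible n \<gamma> \<longrightarrow> \<gamma> \<le> gamma n)"
proof -
  let ?S = "Collect (admissible n)"
  define c where "c = Sup ?S"
  have bdd: "bdd_above ?S" using admissible_upper by (intro bdd_aboveI) auto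
  have ne: "?S \<noteq> {}" using admissible_lower by blast
  have ub: "\<gamma> \<le> c" if "admissible n \<gamma>" for \<gamma>
    unfolding c_def using that bdd by (intro cSup_upper) auto
  have adm: "admissible n c"
    unfolding admissible_def
  proof (intro allI impI)
    fix \<epsilon> :: real assume e: "\<epsilon> > 0"
    then have "c - \<epsilon> / 2 < Sup ?S" by (simp add: c_def)
    then obtain \<gamma> where g: "admissible n \<gamma>" "c - \<epsilon> / 2 < \<gamma>"
      using less_cSupE[OF _ ne] by blast
    from e have "\<epsilon> / 2 > 0" by simp
    with g(1) obtain H0 where H0: "H0 \<ge> 1"
      "\<forall>H\<ge>H0. \<forall>f :: int poly. degree f = n \<and> monic f \<longrightarrow>
         real (R_count n H f) \<le> H powr ((real n)\<^sup>2 - real n - \<gamma> + \<epsilon> / 2)"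
      unfolding admissible_def by meson
    have "H powr ((real n)\<^sup>2 - real n - \<gamma> + \<epsilon> / 2) \<le> H powr ((real n)\<^sup>2 - real n - c + \<epsilon>)"
      if "H \<ge> H0" for H
      using that H0(1) g(2) by (intro powr_mono) auto
    then show "\<exists>H0\<ge>1. \<forall>H\<ge>H0. \<forall>f :: int poly. degree f = n \<and> monic f \<longrightarrow>
         real (R_count n H f) \<le> H powr ((real n)\<^sup>2 - real n - c + \<epsilon>)"
      using H0 by (meson order_trans)
  qed
  have "gamma n = c"
    unfolding gamma_def using adm ub by (intro Greatest_equality) auto
  then show ?thesis using adm ub by simp
qed

end

(* Write a 3 x 3 matrix as a 2 x 2 block B bordered by a column u, a row v and a corner entry.
   Given B and f, the corner entry is fixed by the trace, and the two remaining coefficients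
   fix v u and v adj(B) u. The binary quadratic forms det(u, B u) and det(v, v B) multiply to a number
   depending only on B and f. If it is nonzero and B has nonzero discriminant, then u represents
   a divisor of a fixed nonzero number by a fixed form, which has H^o(1) solutions of height H;
   and u determines v. This gives H^(4+o(1)) matrices. If one of the forms vanishes, say the first, then
   u is zero or an eigenvector of B, so that an integer eigenvalue of B (or the corner entry)
   is a root of f, which again leaves at most H^(4+o(1)) choices; so do the H^(2+o(1)) blocks B
   of discriminant zero.

   Representations by a form of discriminant D are solutions of X^2 - D Y^2 = N. For squarefree D
   the primitive solutions fall into at most as many classes as N has divisors, according to X/Y modulo N;
   two in one class differ by a solution of S^2 - D T^2 = 4, and the values T > 0 of these grow geometrically. *)

theory Submission
  imports Defs "HOL-Computational_Algebra.Computational_Algebra"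
begin

text \<open>The coefficients of f are not bounded in terms of H, yet the estimates must be uniform
  in f. So the size of an integer built from f is never assumed: it is read off from one solution,
  and the count is trivial if there is none. All factors H^o(1) are powers of a single number T that
  bounds the number of divisors of every nonzero integer up to 256 h^6, where h is the integer part
  of H; even the logarithmic number of units is absorbed in T, since 2^k has k + 1 positive
  divisors. Real exponents enter only through the estimate of T. Squarefree D matters when two
  solutions of one class are compared: N splits as d k, the ratios agree modulo d and modulo k, and
  agreement modulo N is lost only by gcd(d, k). The square of this gcd divides 4 D, so it divides 2,
  which explains the norm 4 instead of 1. For n = 2 the equation b c = a (t - a) - \<delta> leaves
  H^(1+o(1)) matrices, and X^2 already has at least H of them, the strictly upper triangular ones;
  hence the exact value of \<open>gamma 2\<close>.\<close>

lemma card_le_fibers: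
  assumes "finite S" "finite F" "f ` S \<subseteq> F" "\<And>y. y \<in> F \<Longrightarrow> card {x \<in> S. f x = y} \<le> n"
  shows "card S \<le> card F * n"
proof -
  have "S = (\<Union>y\<in>F. {x \<in> S. f x = y})" using assms(3) by auto
  then have "card S \<le> (\<Sum>y\<in>F. card {x \<in> S. f x = y})"
    using card_UN_le[OF assms(2), of "\<lambda>y. {x \<in> S. f x = y}"] by metis
  also have "\<dots> \<le> card F * n" using assms(4) sum_bounded_above[of F _ n] by auto
  finally show ?thesis .
qed

lemma card_le_if_nonempty: "(S \<noteq> {} \<Longrightarrow> card S \<le> n) \<Longrightarrow> card S \<le> n"
  by (cases "S = {}") auto

text \<open>Divisors of both signs are counted. Keeping T and M abstract makes all later counts
  statements about natural numbers and integers, without real exponents.\<close>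

definition divisor_bound :: "nat \<Rightarrow> int \<Rightarrow> bool" where
  "divisor_bound T M \<longleftrightarrow> (\<forall>n. n \<noteq> 0 \<and> \<bar>n\<bar> \<le> M \<longrightarrow> card {d. d dvd n} \<le> T)"

lemma divisor_boundD: "divisor_bound T M \<Longrightarrow> n \<noteq> 0 \<Longrightarrow> \<bar>n\<bar> \<le> M \<Longrightarrow> card {d. d dvd n} \<le> T"
  by (auto simp: divisor_bound_def)

lemma finite_int_divisors: "n \<noteq> 0 \<Longrightarrow> finite {d::int. d dvd n}"
  by simp

lemma divisor_bound_ge_1:
  assumes "divisor_bound T M" "M \<ge> 1" shows "T \<ge> 1"
proof -
  have "card {d::int. d dvd 1} \<le> T" using assms by (intro divisor_boundD) auto
  moreover have "card {d::int. d dvd 1} \<ge> 1"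
    using card_mono[OF finite_int_divisors[of 1], of "{1}"] by simp
  ultimately show ?thesis by simp
qed

text \<open>The powers 1, 2, ..., 2^k are k + 1 divisors of 2^k. This lets logarithmic factors be
  replaced by T.\<close>

lemma log_le_divisor_bound:
  assumes "divisor_bound T M" "2 ^ k \<le> M" shows "k + 1 \<le> T"
proof -
  have "card ((\<lambda>i. 2 ^ i :: int) ` {..k}) = k + 1"
    by (subst card_image) (auto intro!: inj_onI)
  moreover have "card ((\<lambda>i. 2 ^ i :: int) ` {..k}) \<le> card {d::int. d dvd 2 ^ k}"
    by (intro card_mono finite_int_divisors) (auto intro: le_imp_power_dvd)
  moreover have "card {d::int. d dvd 2 ^ k} \<le> T" using assms by (intro divisor_boundD) auto
  ultimately show ?thesis by simp
qed

lemma card_square_eq: "card {x::int. x\<^sup>2 = a} \<le> 2"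
proof (cases "{x::int. x\<^sup>2 = a} = {}")
  case False
  then obtain y where "y\<^sup>2 = a" by auto
  then have "{x::int. x\<^sup>2 = a} \<subseteq> {y, - y}" by (auto simp: power2_eq_iff)
  then have "card {x::int. x\<^sup>2 = a} \<le> card {y, - y}" by (intro card_mono) auto
  also have "\<dots> \<le> 2" by (simp add: card_insert_if)
  finally show ?thesis .
qed simp

lemma finite_square_eq: "finite {x::int. x\<^sup>2 = a}"
proof (rule finite_subset)
  show "{x::int. x\<^sup>2 = a} \<subseteq> {- \<bar>a\<bar>..\<bar>a\<bar>}"
  proof
    fix x :: int assume "x \<in> {x. x\<^sup>2 = a}"
    then have "a = \<bar>x\<bar> * \<bar>x\<bar>" by (simp add: power2_eq_square flip: abs_mult)
    moreover have "\<bar>x\<bar> \<le> \<bar>x\<bar> * \<bar>x\<bar>"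
      using mult_left_mono[of 1 "\<bar>x\<bar>" "\<bar>x\<bar>"] by (cases "x = 0") simp_all
    ultimately have "\<bar>x\<bar> \<le> \<bar>a\<bar>" by linarith
    then show "x \<in> {- \<bar>a\<bar>..\<bar>a\<bar>}" by auto
  qed
qed simp

subsection \<open>Norm equations\<close>

text \<open>The product of S' + T' sqrt D with the conjugate of S + T sqrt D is P + Q sqrt D, of
  norm 16. Here T < T' forces Q \<ge> 1, so P^2 \<ge> 16 + D > 16 and the integer P is at least 5.
  Multiplying back by S + T sqrt D gives 4 T' = P T + Q S \<ge> 5 T.\<close>

lemma pell_gap:
  fixes S T S' T' D :: int
  assumes D: "D \<ge> 2" and e: "S\<^sup>2 - D * T\<^sup>2 = 4" "S'\<^sup>2 - D * T'\<^sup>2 = 4"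
    and S: "S > 0" "S' > 0" and T: "0 < T" "T < T'"
  shows "5 * T \<le> 4 * T'"
proof -
  define P Q where "P = S * S' - D * T * T'" and "Q = S * T' - S' * T"
  have PQ: "P\<^sup>2 - D * Q\<^sup>2 = 16"
  proof -
    have "P\<^sup>2 - D * Q\<^sup>2 = (S\<^sup>2 - D * T\<^sup>2) * (S'\<^sup>2 - D * T'\<^sup>2)"
      unfolding P_def Q_def by (simp add: algebra_simps power2_eq_square)
    with e show ?thesis by simp
  qed
  have "(S * T')\<^sup>2 - (S' * T)\<^sup>2 = (4 + D * T\<^sup>2) * T'\<^sup>2 - (4 + D * T'\<^sup>2) * T\<^sup>2"
    using e by (simp add: power_mult_distrib algebra_simps)
  also have "\<dots> = 4 * (T'\<^sup>2 - T\<^sup>2)" by (simp add: algebra_simps)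
  also have "\<dots> > 0" using T by (simp add: power_strict_mono)
  finally have "(S' * T)\<^sup>2 < (S * T')\<^sup>2" by simp
  then have "S' * T < S * T'" using S T by (auto intro: power_less_imp_less_base)
  then have Q: "Q \<ge> 1" by (simp add: Q_def)
  have "(S * S')\<^sup>2 = (4 + D * T\<^sup>2) * (4 + D * T'\<^sup>2)" using e by (simp add: power_mult_distrib algebra_simps)
  also have "\<dots> = (D * T * T')\<^sup>2 + (16 + 4 * D * T\<^sup>2 + 4 * D * T'\<^sup>2)"
    by (simp add: algebra_simps power2_eq_square)
  finally have "(D * T * T')\<^sup>2 < (S * S')\<^sup>2" using D by (simp add: add_pos_nonneg)
  then have "D * T * T' < S * S'" using S D T by (auto intro: power_less_imp_less_base)
  then have P0: "P > 0" by (simp add: P_def)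
  have "Q\<^sup>2 \<ge> 1" using Q by (simp add: one_le_power)
  then have "D * Q\<^sup>2 \<ge> 2 * 1" using D by (intro mult_mono) auto
  then have "4\<^sup>2 < P\<^sup>2" using PQ by simp
  then have "4 < P" by (rule power_less_imp_less_base) (use P0 in simp)
  then have P: "P \<ge> 5" by simp
  have "4 * T' = (S\<^sup>2 - D * T\<^sup>2) * T'" using e by simp
  also have "\<dots> = P * T + Q * S" by (simp add: P_def Q_def algebra_simps power2_eq_square)
  finally have "4 * T' = P * T + Q * S" .
  moreover have "5 * T \<le> P * T" using P T by (intro mult_right_mono) auto
  moreover have "0 \<le> Q * S" using Q S by simp
  ultimately show ?thesis by linarith
qed

lemma gap_set_Max:
  fixes A :: "int set"
  assumes "finite A" "A \<noteq> {}" "\<And>x. x \<in> A \<Longrightarrow> x \<ge> 1"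
    and "\<And>x y. x \<in> A \<Longrightarrow> y \<in> A \<Longrightarrow> x < y \<Longrightarrow> 5 * x \<le> 4 * y"
  shows "5 ^ (card A - 1) \<le> 4 ^ (card A - 1) * Max A"
  using assms
proof (induction A rule: finite_linorder_max_induct)
  case (insert b A)
  have Max: "Max (insert b A) = b" using insert by (intro Max_eqI) (auto simp: less_imp_le)
  show ?case
  proof (cases "A = {}")
    case True then show ?thesis using insert by auto
  next
    case False
    have IH: "5 ^ (card A - 1) \<le> 4 ^ (card A - 1) * Max A"
      using insert.IH[OF False] insert.prems by blast
    have "5 * Max A \<le> 4 * b" using insert False by (auto intro!: insert.prems(3))
    moreover have c: "card (insert b A) - 1 = Suc (card A - 1)"
      using insert False card_gt_0_iff[of A] by auto
    moreover have "5 * (4 ^ (card A - 1) * Max A) \<le> 4 ^ (card A - 1) * (4 * b)"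
      using calculation(1) by (simp add: mult.left_commute[of 5])
    ultimately have "5 * 5 ^ (card A - 1) \<le> 4 ^ (card A - 1) * (4 * b)" using IH by linarith
    then show ?thesis unfolding Max c power_Suc by (simp only: mult_ac)
  qed
qed simp

text \<open>Four gaps multiply by (5/4)^4 = 625/256 > 2, so 2^q \<le> M when q is a quarter of the
  number of gaps, rounded down; then q + 1 \<le> T.\<close>

lemma card_gap_set:
  fixes A :: "int set"
  assumes T: "divisor_bound T M" "M \<ge> 1" and A: "A \<subseteq> {1..M}"
    and gap: "\<And>x y. x \<in> A \<Longrightarrow> y \<in> A \<Longrightarrow> x < y \<Longrightarrow> 5 * x \<le> 4 * y"
  shows "card A \<le> 4 * T"
proof (cases "A = {}")
  case False
  have fin: "finite A" using A finite_subset by blast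
  define n where "n = card A - 1"
  define q where "q = n div 4"
  have "5 ^ n \<le> 4 ^ n * Max A"
    unfolding n_def using A gap False fin by (intro gap_set_Max) auto
  also have "\<dots> \<le> 4 ^ n * M" using A fin False by (intro mult_left_mono) auto
  finally have 1: "(5::int) ^ n \<le> 4 ^ n * M" .
  obtain r where n: "n = 4 * q + r" by (metis q_def mult_div_mod_eq)
  have "4 ^ n * (2::int) ^ q = (4 ^ 4 * 2) ^ q * 4 ^ r"
    unfolding n power_add power_mult power_mult_distrib by (simp only: mult_ac)
  also have "\<dots> \<le> (5 ^ 4) ^ q * 5 ^ r" by (intro mult_mono power_mono) auto
  also have "\<dots> = 5 ^ n" unfolding n power_add power_mult by (rule refl)
  finally have "4 ^ n * (2::int) ^ q \<le> 4 ^ n * M" using 1 by linarith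
  then have "2 ^ q \<le> M" by simp
  then have "q + 1 \<le> T" using log_le_divisor_bound T by blast
  then show ?thesis unfolding q_def n_def by linarith
qed simp

text \<open>Y determines S up to sign. For D < 0 the equation forces \<bar>Y\<bar> \<le> 2, which
  gives at most 10 pairs. For D \<ge> 2 the positive Y have ratios at least 5/4, so there are at
  most 4 T of them; with their negatives and 0 this makes 9 T values of Y and 18 T pairs.\<close>

lemma card_units:
  fixes D :: int
  assumes T: "divisor_bound T M" "M \<ge> 1" and D: "D < 0 \<or> D \<ge> 2"
  shows "finite {(S, Y). S\<^sup>2 - D * Y\<^sup>2 = 4 \<and> \<bar>Y\<bar> \<le> M} \<and>
    card {(S, Y). S\<^sup>2 - D * Y\<^sup>2 = 4 \<and> \<bar>Y\<bar> \<le> M} \<le> 25 * T"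
proof -
  let ?U = "{(S, Y). S\<^sup>2 - D * Y\<^sup>2 = 4 \<and> \<bar>Y\<bar> \<le> M}"
  have T1: "T \<ge> 1" using divisor_bound_ge_1 T by blast
  have fin: "finite ?U"
  proof (rule finite_subset)
    show "?U \<subseteq> (SIGMA Y:{-M..M}. {S. S\<^sup>2 = 4 + D * Y\<^sup>2})\<inverse>" by auto
    show "finite ((SIGMA Y:{-M..M}. {S. S\<^sup>2 = 4 + D * Y\<^sup>2})\<inverse>)"
      by (simp add: finite_square_eq)
  qed
  have fib: "card {z \<in> ?U. snd z = y} \<le> 2" for y
  proof -
    have "card {z \<in> ?U. snd z = y} \<le> card ((\<lambda>s. (s, y)) ` {S. S\<^sup>2 = 4 + D * y\<^sup>2})"
      by (intro card_mono finite_imageI finite_square_eq) auto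
    also have "\<dots> \<le> card {S. S\<^sup>2 = 4 + D * y\<^sup>2}" by (intro card_image_le finite_square_eq)
    also have "\<dots> \<le> 2" by (rule card_square_eq)
    finally show ?thesis .
  qed
  show ?thesis
  proof (cases "D < 0")
    case True
    have "Y \<in> {-2..2}" if "S\<^sup>2 - D * Y\<^sup>2 = 4" for S Y :: int
    proof -
      have "1 * Y\<^sup>2 \<le> (- D) * Y\<^sup>2" using True by (intro mult_right_mono) auto
      then have "Y\<^sup>2 \<le> - (D * Y\<^sup>2)" by simp
      moreover have "S\<^sup>2 \<ge> 0" by simp
      ultimately have "Y\<^sup>2 \<le> 2\<^sup>2" using that unfolding power2_eq_square[of 2] by linarith
      then show ?thesis using abs_le_square_iff[of Y 2] by auto
    qed
    then have "card ?U \<le> card {-2..2::int} * 2"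
      using fin fib by (intro card_le_fibers[where f = snd]) auto
    then show ?thesis using fin T1 by simp
  next
    case False
    define A where "A = {Y. 1 \<le> Y \<and> Y \<le> M \<and> (\<exists>S. S\<^sup>2 - D * Y\<^sup>2 = 4)}"
    have A: "A \<subseteq> {1..M}" by (auto simp: A_def)
    have finA: "finite A" using A finite_subset by blast
    have "card A \<le> 4 * T"
    proof (rule card_gap_set[OF T A])
      fix x y assume xy: "x \<in> A" "y \<in> A" "x < y"
      then obtain s s' where s: "s\<^sup>2 - D * x\<^sup>2 = 4" "s'\<^sup>2 - D * y\<^sup>2 = 4" by (auto simp: A_def)
      have "s \<noteq> 0 \<and> s' \<noteq> 0"
      proof -
        have "D * x\<^sup>2 \<ge> 0" "D * y\<^sup>2 \<ge> 0" using False D by auto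
        then show ?thesis using s by auto
      qed
      then show "5 * x \<le> 4 * y"
        using pell_gap[of D "\<bar>s\<bar>" x "\<bar>s'\<bar>" y] s xy False D by (auto simp: A_def)
    qed
    moreover have "card (uminus ` A) \<le> card A" using finA by (rule card_image_le)
    moreover have "card ({0} \<union> (A \<union> uminus ` A)) \<le> 1 + (card A + card (uminus ` A))"
      using card_Un_le[of "{0}" "A \<union> uminus ` A"] card_Un_le[of A "uminus ` A"] by simp
    ultimately have F: "card ({0} \<union> (A \<union> uminus ` A)) \<le> 9 * T" using T1 by linarith
    have "snd ` ?U \<subseteq> {0} \<union> (A \<union> uminus ` A)"
    proof clarsimp
      fix S Y assume *: "S\<^sup>2 - D * Y\<^sup>2 = 4" "\<bar>Y\<bar> \<le> M" "Y \<noteq> 0" "Y \<notin> uminus ` A"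
      have "- Y \<notin> A" using *(4) by (metis imageI minus_minus)
      then show "Y \<in> A" using * by (auto simp: A_def)
    qed
    then have "card ?U \<le> card ({0} \<union> (A \<union> uminus ` A)) * 2"
      using fin finA fib by (intro card_le_fibers[where f = snd]) auto
    then show ?thesis using fin F T1 by simp
  qed
qed

section \<open>Classes of primitive solutions modulo the norm\<close>

lemma square_dvd_4_squarefree:
  fixes h D :: int
  assumes "squarefree D" "h\<^sup>2 dvd 4 * D"
  shows "h dvd 2"
proof (cases "even h")
  case True
  then obtain k where k: "h = 2 * k" by blast
  have "k\<^sup>2 dvd D" using assms(2) by (simp add: k power_mult_distrib)
  then have "k dvd 1" using assms(1) squarefreeD by blast
  then show ?thesis by (simp add: k)
next
  case False
  then have "coprime (h\<^sup>2) 4" using coprime_power_left_iff[of h 2 "4::int"] coprime_power_right_iff[of h 2 2]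
    by simp
  then have "h\<^sup>2 dvd D" using assms(2) by (simp add: coprime_dvd_mult_right_iff)
  then have "h dvd 1" using assms(1) squarefreeD by blast
  then show ?thesis by (meson dvd_trans one_dvd)
qed

text \<open>The product (X1 Y - X Y1) (X1 Y + X Y1) is a multiple of N for every solution (X, Y). If
  d is the gcd of N with the first factor, then k = N / d divides the second one. So d fixes the
  ratio X/Y modulo d and modulo k: it is X1/Y1 modulo d and -X1/Y1 modulo k. Two solutions with the
  same d therefore agree modulo lcm(d, k), and the factor 2 pays for the passage to N.\<close>

lemma norm_class_ratio:
  fixes X1 Y1 X2 Y2 X3 Y3 D N :: int
  assumes N: "N \<noteq> 0" and D: "squarefree D"
    and e: "X1\<^sup>2 - D * Y1\<^sup>2 = N" "X2\<^sup>2 - D * Y2\<^sup>2 = N" "X3\<^sup>2 - D * Y3\<^sup>2 = N"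
    and c: "coprime X1 Y1" "coprime X2 Y2"
    and g: "gcd N (X1 * Y2 - X2 * Y1) = gcd N (X1 * Y3 - X3 * Y1)"
  shows "N dvd 2 * (X2 * Y3 - X3 * Y2)"
proof -
  \<comment> \<open>Y is invertible modulo N, because gcd(Y, N) = gcd(Y, X^2) = 1; only this makes
    the ratio X/Y meaningful.\<close>
  have cop: "coprime Y N" if "X\<^sup>2 - D * Y\<^sup>2 = N" "coprime X Y" for X Y :: int
  proof -
    have "gcd Y N = gcd Y (X\<^sup>2 + (- D * Y) * Y)" using that(1) by (simp add: algebra_simps power2_eq_square)
    also have "\<dots> = gcd Y (X\<^sup>2)" by (metis gcd_add_mult add.commute)
    also have "\<dots> = 1" using that(2) by (metis coprime_commute coprime_imp_gcd_eq_1 coprime_power_right_iff)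
    finally show ?thesis by (simp add: coprime_iff_gcd_eq_1)
  qed
  define d where "d = gcd N (X1 * Y2 - X2 * Y1)"
  have d0: "d \<noteq> 0" using N by (simp add: d_def)
  have dN: "d dvd N" by (simp add: d_def)
  define k where "k = N div d"
  have Nk: "N = d * k" using dN by (simp add: k_def)
  have sum: "k dvd X1 * Y + X * Y1"
    if XY: "X\<^sup>2 - D * Y\<^sup>2 = N" "d = gcd N (X1 * Y - X * Y1)" for X Y
  proof -
    have "(X1 * Y - X * Y1) * (X1 * Y + X * Y1) = X1\<^sup>2 * Y\<^sup>2 - X\<^sup>2 * Y1\<^sup>2"
      by (simp add: algebra_simps power2_eq_square)
    also have "\<dots> = (N + D * Y1\<^sup>2) * Y\<^sup>2 - (N + D * Y\<^sup>2) * Y1\<^sup>2"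
      using e(1) XY(1) by (simp add: algebra_simps)
    also have "\<dots> = N * (Y\<^sup>2 - Y1\<^sup>2)" by (simp add: algebra_simps)
    finally have "N dvd (X1 * Y - X * Y1) * (X1 * Y + X * Y1)" by simp
    moreover obtain w where w: "X1 * Y - X * Y1 = d * w" using XY(2) by (metis dvdE gcd_dvd2)
    ultimately have "d * k dvd d * (w * (X1 * Y + X * Y1))" by (simp add: Nk mult.assoc)
    then have "k dvd w * (X1 * Y + X * Y1)" using d0 by simp
    \<comment> \<open>Since d is the full gcd of d k and d w, nothing common remains in k and
      w.\<close>
    moreover have "coprime k w"
    proof -
      have "d = gcd (d * k) (d * w)" using XY(2) w Nk by simp
      also have "\<dots> = \<bar>d\<bar> * gcd k w" by (simp add: gcd_mult_distrib_int)
      finally have "\<bar>d\<bar> = \<bar>d\<bar> * gcd k w" by (metis abs_abs abs_gcd_int abs_mult)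
      then show ?thesis using d0 by (simp add: coprime_iff_gcd_eq_1)
    qed
    ultimately show ?thesis by (simp add: coprime_dvd_mult_right_iff)
  qed
  have s2: "k dvd X1 * Y2 + X2 * Y1" by (rule sum[OF e(2) d_def])
  have s3: "k dvd X1 * Y3 + X3 * Y1" by (rule sum[OF e(3)]) (simp add: d_def g)
  have w2: "d dvd X1 * Y2 - X2 * Y1" by (simp add: d_def)
  have w3: "d dvd X1 * Y3 - X3 * Y1" by (simp add: d_def g)
  have c1: "coprime Y1 N" and c2: "coprime Y2 N" using cop e c by blast+
  have cop_div: "coprime Y z" if "coprime Y N" "z dvd N" for Y z
    using that by (meson coprime_divisors dvd_refl)
  have kN: "k dvd N" by (simp add: Nk)
  have "d dvd Y1 * (X2 * Y3 - X3 * Y2)"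
  proof -
    have "Y1 * (X2 * Y3 - X3 * Y2) = (X1 * Y3 - X3 * Y1) * Y2 - (X1 * Y2 - X2 * Y1) * Y3"
      by (simp add: algebra_simps)
    then show ?thesis using w2 w3 by (metis dvd_diff dvd_mult2)
  qed
  then have dW: "d dvd X2 * Y3 - X3 * Y2"
    using cop_div[OF c1 dN] by (simp add: coprime_dvd_mult_right_iff coprime_commute)
  have "k dvd Y1 * (X2 * Y3 - X3 * Y2)"
  proof -
    have "Y1 * (X2 * Y3 - X3 * Y2) = (X1 * Y2 + X2 * Y1) * Y3 - (X1 * Y3 + X3 * Y1) * Y2"
      by (simp add: algebra_simps)
    then show ?thesis using s2 s3 by (metis dvd_diff dvd_mult2)
  qed
  then have kW: "k dvd X2 * Y3 - X3 * Y2"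
    using cop_div[OF c1 kN] by (simp add: coprime_dvd_mult_right_iff coprime_commute)
  \<comment> \<open>h is what separates lcm(d, k) from d k = N. Adding the two divisibilities for
    the second solution gives h dvd 2 X1 Y2, hence h dvd 2 X1; as h^2 divides N = X1^2 - D Y1^2, it
    divides 4 D.\<close>
  define h where "h = gcd d k"
  have hd: "h dvd d" "h dvd k" by (simp_all add: h_def)
  have hN2: "h\<^sup>2 dvd N" using hd by (simp add: Nk power2_eq_square mult_dvd_mono)
  have "h dvd (X1 * Y2 - X2 * Y1) + (X1 * Y2 + X2 * Y1)"
    using hd w2 s2 by (meson dvd_add dvd_trans)
  then have "h dvd Y2 * (2 * X1)" by (simp add: algebra_simps)
  moreover have "coprime Y2 h" using cop_div[OF c2] hd(1) dN dvd_trans by blast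
  ultimately have "h dvd 2 * X1" by (simp add: coprime_dvd_mult_right_iff coprime_commute)
  then have "h\<^sup>2 dvd (2 * X1)\<^sup>2" by (rule dvd_power_same)
  also have "(2 * X1)\<^sup>2 = 4 * N + 4 * D * Y1\<^sup>2" using e(1) by (simp add: algebra_simps power_mult_distrib)
  finally have "h\<^sup>2 dvd 4 * D * Y1\<^sup>2" using hN2 dvd_add_right_iff[of "h\<^sup>2" "4 * N" "4 * D * Y1\<^sup>2"] by simp
  moreover have "coprime (h\<^sup>2) (Y1\<^sup>2)"
    using cop_div[OF c1] hd(1) dN dvd_trans coprime_commute by (metis coprime_power_left_iff coprime_power_right_iff)
  ultimately have "h\<^sup>2 dvd 4 * D" by (simp add: coprime_dvd_mult_left_iff)
  then have h2: "h dvd 2" using D square_dvd_4_squarefree by blast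
  have "N dvd lcm d k * h" using lcm_mult_gcd[of d k] by (simp add: h_def Nk flip: abs_mult)
  also have "lcm d k * h dvd (X2 * Y3 - X3 * Y2) * 2" using dW kW h2 by (intro mult_dvd_mono) (auto intro: lcm_least)
  finally show ?thesis by (simp add: mult.commute)
qed

text \<open>One reference solution (X1, Y1) sorts all solutions into at most T classes, one for each
  divisor of N. Within a class, division by a fixed member (X2, Y2) and multiplication by 2 gives an
  injection into the pairs of norm 4. The condition 4 L K \<le> M keeps their second component in
  the range where these pairs are counted.\<close>

lemma card_primitive_norm_solutions:
  fixes D N L K M :: int
  assumes T: "divisor_bound T M" "M \<ge> 1" and D: "squarefree D" "D \<noteq> 1" and N: "N \<noteq> 0" "\<bar>N\<bar> \<le> M"
    and LK: "L \<ge> 0" "K \<ge> 0" "4 * L * K \<le> M"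
  shows "card {(X, Y). X\<^sup>2 - D * Y\<^sup>2 = N \<and> coprime X Y \<and> \<bar>X\<bar> \<le> L \<and> \<bar>Y\<bar> \<le> K} \<le> T * (25 * T)"
proof (rule card_le_if_nonempty)
  let ?S = "{(X, Y). X\<^sup>2 - D * Y\<^sup>2 = N \<and> coprime X Y \<and> \<bar>X\<bar> \<le> L \<and> \<bar>Y\<bar> \<le> K}"
  assume ne: "?S \<noteq> {}"
  let ?U = "{(S, Y). S\<^sup>2 - D * Y\<^sup>2 = 4 \<and> \<bar>Y\<bar> \<le> M}"
  have D2: "D < 0 \<or> D \<ge> 2" using D by (cases "D = 0") auto
  note U = card_units[OF T D2]
  have "?S \<subseteq> {-L..L} \<times> {-K..K}" by auto
  then have fin: "finite ?S" by (rule finite_subset) simp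
  obtain X1 Y1 where z1: "X1\<^sup>2 - D * Y1\<^sup>2 = N" "coprime X1 Y1" using ne by auto
  have "card ?S \<le> card {d. d dvd N} * (25 * T)"
  proof (rule card_le_fibers[where f = "\<lambda>(X, Y). gcd N (X1 * Y - X * Y1)"])
    show "finite {d. d dvd N}" using N(1) by simp
    fix d
    let ?C = "{z \<in> ?S. (case z of (X, Y) \<Rightarrow> gcd N (X1 * Y - X * Y1)) = d}"
    show "card ?C \<le> 25 * T"
    proof (rule card_le_if_nonempty)
      assume "?C \<noteq> {}"
      then obtain X2 Y2 where z2: "X2\<^sup>2 - D * Y2\<^sup>2 = N" "coprime X2 Y2" "\<bar>X2\<bar> \<le> L" "\<bar>Y2\<bar> \<le> K"
        "gcd N (X1 * Y2 - X2 * Y1) = d" by auto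
      \<comment> \<open>The components are those of 2 (X + Y sqrt D) (X2 - Y2 sqrt D) / N, which is
        twice the quotient of the two solutions.\<close>
      let ?f = "\<lambda>(X, Y). (2 * (X2 * X - D * Y2 * Y) div N, 2 * (X2 * Y - X * Y2) div N)"
      have key: "N dvd 2 * (X2 * Y - X * Y2) \<and> N dvd 2 * (X2 * X - D * Y2 * Y) \<and>
          (2 * (X2 * X - D * Y2 * Y) div N)\<^sup>2 - D * (2 * (X2 * Y - X * Y2) div N)\<^sup>2 = 4"
        if "(X, Y) \<in> ?C" for X Y
      proof -
        from that have z: "X\<^sup>2 - D * Y\<^sup>2 = N" "coprime X Y" "gcd N (X1 * Y - X * Y1) = d" by auto
        have n1: "N dvd 2 * (X2 * Y - X * Y2)"
          using norm_class_ratio[OF N(1) D(1) z1(1) z2(1) z(1) z1(2) z2(2)] z2(5) z(3) by simp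
        then obtain b where b: "2 * (X2 * Y - X * Y2) = N * b" by blast
        define a where "a = 2 * (X2 * X - D * Y2 * Y)"
        have "a\<^sup>2 - D * (2 * (X2 * Y - X * Y2))\<^sup>2 = 4 * ((X2\<^sup>2 - D * Y2\<^sup>2) * (X\<^sup>2 - D * Y\<^sup>2))"
          unfolding a_def by (simp add: algebra_simps power2_eq_square)
        \<comment> \<open>By multiplicativity of the norm, a^2 = N^2 (4 + D b^2). So divisibility of
          the second component by N already forces that of the first.\<close>
        then have ab: "a\<^sup>2 - D * (N * b)\<^sup>2 = 4 * N\<^sup>2" using z(1) z2(1) b by (simp add: power2_eq_square)
        then have "a\<^sup>2 = N\<^sup>2 * (4 + D * b\<^sup>2)" by (simp add: algebra_simps power_mult_distrib)
        then have "N\<^sup>2 dvd a\<^sup>2" by simp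
        then have n2: "N dvd a" by simp
        then obtain a' where a': "a = N * a'" by blast
        have "N\<^sup>2 * (a'\<^sup>2 - D * b\<^sup>2) = N\<^sup>2 * 4" using ab a' by (simp add: algebra_simps power_mult_distrib)
        then have "a'\<^sup>2 - D * b\<^sup>2 = 4" using N(1) by simp
        then show ?thesis using n1 n2 b a' N(1) unfolding a_def by simp
      qed
      have "card ?C \<le> card ?U"
      proof (rule card_inj_on_le[where f = ?f])
        show "finite ?U" using U by blast
        show "inj_on ?f ?C"
        proof (rule inj_onI)
          fix z z' assume zz: "z \<in> ?C" "z' \<in> ?C" "?f z = ?f z'"
          obtain X Y X' Y' where z: "z = (X, Y)" "z' = (X', Y')" by (metis surj_pair)
          have k: "N dvd 2 * (X2 * Y - X * Y2)" "N dvd 2 * (X2 * X - D * Y2 * Y)"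
            "N dvd 2 * (X2 * Y' - X' * Y2)" "N dvd 2 * (X2 * X' - D * Y2 * Y')"
            using key zz(1,2) unfolding z by blast+
          have "2 * (X2 * X - D * Y2 * Y) div N = 2 * (X2 * X' - D * Y2 * Y') div N"
            "2 * (X2 * Y - X * Y2) div N = 2 * (X2 * Y' - X' * Y2) div N"
            using zz(3) unfolding z by simp_all
          then have "2 * (X2 * X - D * Y2 * Y) = 2 * (X2 * X' - D * Y2 * Y')"
            "2 * (X2 * Y - X * Y2) = 2 * (X2 * Y' - X' * Y2)"
            using k by (metis dvd_div_mult_self)+
          then have E: "X2 * X - D * Y2 * Y = X2 * X' - D * Y2 * Y'" "X2 * Y - X * Y2 = X2 * Y' - X' * Y2"
            by simp_all
          \<comment> \<open>Multiplying the product by X2 + Y2 sqrt D returns N (X + Y sqrt D), so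
            the quotient determines the solution.\<close>
          have "N * X = X2 * (X2 * X - D * Y2 * Y) + D * Y2 * (X2 * Y - X * Y2)"
            "N * X' = X2 * (X2 * X' - D * Y2 * Y') + D * Y2 * (X2 * Y' - X' * Y2)"
            "N * Y = X2 * (X2 * Y - X * Y2) + Y2 * (X2 * X - D * Y2 * Y)"
            "N * Y' = X2 * (X2 * Y' - X' * Y2) + Y2 * (X2 * X' - D * Y2 * Y')"
            by (simp_all add: z2(1)[symmetric] algebra_simps power2_eq_square)
          then have "N * X = N * X'" "N * Y = N * Y'" using E by simp_all
          then show "z = z'" using N(1) unfolding z by simp
        qed
        show "?f ` ?C \<subseteq> ?U"
        proof
          fix u assume "u \<in> ?f ` ?C"
          then obtain X Y where XY: "(X, Y) \<in> ?C" "u = ?f (X, Y)" by (metis (no_types, lifting) imageE surj_pair)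
          have b: "\<bar>X\<bar> \<le> L" "\<bar>Y\<bar> \<le> K" using XY(1) by auto
          have n: "N dvd 2 * (X2 * Y - X * Y2)" using key XY(1) by blast
          then obtain q where q: "2 * (X2 * Y - X * Y2) = N * q" by blast
          have "\<bar>q\<bar> \<le> \<bar>N\<bar> * \<bar>q\<bar>" using N(1) mult_right_mono[of 1 "\<bar>N\<bar>" "\<bar>q\<bar>"] by simp
          also have "\<dots> = \<bar>2 * (X2 * Y - X * Y2)\<bar>" unfolding q by (simp add: abs_mult)
          also have "\<dots> \<le> 2 * (\<bar>X2 * Y\<bar> + \<bar>X * Y2\<bar>)"
            unfolding abs_mult[of 2] using abs_triangle_ineq4[of "X2 * Y" "X * Y2"] by simp
          also have "\<dots> \<le> 2 * (L * K + L * K)"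
            unfolding abs_mult using b z2 LK by (intro mult_left_mono add_mono mult_mono) auto
          also have "\<dots> \<le> M" using LK(3) by (simp add: mult_ac)
          finally have "\<bar>q\<bar> \<le> M" .
          then show "u \<in> ?U" using key[OF XY(1)] q N(1) unfolding XY(2) by simp
        qed
      qed
      then show ?thesis using U by linarith
    qed
  qed (use fin in auto)
  also have "\<dots> \<le> T * (25 * T)" using T N by (intro mult_right_mono divisor_boundD) auto
  finally show ?thesis .
qed

text \<open>For D = 1 the norm splits as (X - Y) (X + Y), and the divisor X - Y of N determines the
  solution. Otherwise g = gcd(X, Y) divides N, and division by g leaves a primitive solution of norm
  N / g^2; the choice of g costs one more factor T.\<close>

lemma card_squarefree_norm_solutions:
  fixes D N L K M :: int
  assumes T: "divisor_bound T M" "M \<ge> 1" and D: "squarefree D" and N: "N \<noteq> 0" "\<bar>N\<bar> \<le> M"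
    and LK: "L \<ge> 0" "K \<ge> 0" "4 * L * K \<le> M"
  shows "card {(X, Y). X\<^sup>2 - D * Y\<^sup>2 = N \<and> \<bar>X\<bar> \<le> L \<and> \<bar>Y\<bar> \<le> K} \<le> 25 * T ^ 3"
proof -
  let ?S = "{(X, Y). X\<^sup>2 - D * Y\<^sup>2 = N \<and> \<bar>X\<bar> \<le> L \<and> \<bar>Y\<bar> \<le> K}"
  have T1: "T \<ge> 1" using divisor_bound_ge_1 T by blast
  have "?S \<subseteq> {-L..L} \<times> {-K..K}" by auto
  then have fin: "finite ?S" by (rule finite_subset) simp
  have cN: "card {d. d dvd N} \<le> T" "finite {d. d dvd N}" using T N by (auto intro: divisor_boundD)
  show ?thesis
  proof (cases "D = 1")
    case True
    have "card ?S \<le> card {d. d dvd N}"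
    proof (rule card_inj_on_le[where f = "\<lambda>(X, Y). X - Y"])
      show "inj_on (\<lambda>(X, Y). X - Y) ?S"
      proof (rule inj_onI)
        fix z z' assume zz: "z \<in> ?S" "z' \<in> ?S" "(case z of (X, Y) \<Rightarrow> X - Y) = (case z' of (X, Y) \<Rightarrow> X - Y)"
        obtain X Y X' Y' where z: "z = (X, Y)" "z' = (X', Y')" by (metis surj_pair)
        have *: "X\<^sup>2 - D * Y\<^sup>2 = N" "X'\<^sup>2 - D * Y'\<^sup>2 = N" "X - Y = X' - Y'"
          using zz unfolding z by auto
        have "(X - Y) * (X + Y) = N" "(X' - Y') * (X' + Y') = N"
          using * True by (simp_all add: algebra_simps power2_eq_square)
        then have "X + Y = X' + Y'" using N(1) unfolding *(3) by (metis mult_cancel_left mult_zero_left)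
        then show "z = z'" using *(3) unfolding z by simp
      qed
      show "(\<lambda>(X, Y). X - Y) ` ?S \<subseteq> {d. d dvd N}"
      proof clarify
        fix X Y assume "N = X\<^sup>2 - D * Y\<^sup>2"
        then have "X\<^sup>2 - D * Y\<^sup>2 = (X - Y) * (X + Y)" using True by (simp add: algebra_simps power2_eq_square)
        then show "X - Y dvd X\<^sup>2 - D * Y\<^sup>2" by simp
      qed
    qed fact
    also have "\<dots> \<le> T * 1" using cN by simp
    also have "\<dots> \<le> T * (25 * T ^ 2)" using T1 by (intro mult_left_mono) auto
    finally show ?thesis by (simp add: power3_eq_cube power2_eq_square)
  next
    case False
    have "card ?S \<le> card {d. d dvd N} * (T * (25 * T))"
    proof (rule card_le_fibers[where f = "\<lambda>(X, Y). gcd X Y"])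
      show "(\<lambda>(X, Y). gcd X Y) ` ?S \<subseteq> {d. d dvd N}"
        by (auto intro!: dvd_diff dvd_mult simp: power2_eq_square)
      fix g assume g: "g \<in> {d. d dvd N}"
      let ?C = "{z \<in> ?S. (case z of (X, Y) \<Rightarrow> gcd X Y) = g}"
      let ?P = "{(X, Y). X\<^sup>2 - D * Y\<^sup>2 = N div g\<^sup>2 \<and> coprime X Y \<and> \<bar>X\<bar> \<le> L \<and> \<bar>Y\<bar> \<le> K}"
      have g0: "g \<noteq> 0" using g N by auto
      show "card ?C \<le> T * (25 * T)"
      proof (rule card_le_if_nonempty)
        assume ne: "?C \<noteq> {}"
        have dec: "\<exists>x y. X = g * x \<and> Y = g * y \<and> g\<^sup>2 * (x\<^sup>2 - D * y\<^sup>2) = N \<and> (x, y) \<in> ?P" if "(X, Y) \<in> ?C" for X Y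
        proof -
          from that have XY: "gcd X Y = g" "X\<^sup>2 - D * Y\<^sup>2 = N" "\<bar>X\<bar> \<le> L" "\<bar>Y\<bar> \<le> K" by auto
          obtain x y where xy: "X = g * x" "Y = g * y" "coprime x y"
            using gcd_coprime_exists[of X Y] g0 XY(1) by (metis mult.commute)
          have e: "g\<^sup>2 * (x\<^sup>2 - D * y\<^sup>2) = N"
            unfolding XY(2)[symmetric] xy by (simp add: algebra_simps power_mult_distrib)
          have le: "\<bar>z\<bar> \<le> \<bar>g * z\<bar>" for z using g0 mult_right_mono[of 1 "\<bar>g\<bar>" "\<bar>z\<bar>"] by (simp add: abs_mult)
          have "N div g\<^sup>2 = x\<^sup>2 - D * y\<^sup>2" unfolding e[symmetric] using g0 by simp
          then have "(x, y) \<in> ?P" using xy XY le[of x] le[of y] by auto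
          then show ?thesis using xy e by blast
        qed
        obtain z where z: "z \<in> ?C" using ne by blast
        obtain X Y where XY: "z = (X, Y)" by (metis surj_pair)
        obtain x y where e: "g\<^sup>2 * (x\<^sup>2 - D * y\<^sup>2) = N" using dec[OF z[unfolded XY]] by blast
        then have gN: "g\<^sup>2 * (N div g\<^sup>2) = N" by (metis dvd_triv_left dvd_mult_div_cancel)
        have N': "N div g\<^sup>2 \<noteq> 0" using gN N by auto
        have "\<bar>N div g\<^sup>2\<bar> \<le> \<bar>g\<^sup>2\<bar> * \<bar>N div g\<^sup>2\<bar>" using g0 mult_right_mono[of 1 "\<bar>g\<^sup>2\<bar>" "\<bar>N div g\<^sup>2\<bar>"]
          by (simp add: one_le_power int_one_le_iff_zero_less)
        also have "\<dots> = \<bar>N\<bar>" using gN by (metis abs_mult)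
        finally have "\<bar>N div g\<^sup>2\<bar> \<le> M" using N by simp
        then have P: "card ?P \<le> T * (25 * T)"
          using N' \<open>D \<noteq> 1\<close> T D LK by (intro card_primitive_norm_solutions) auto
        have "?P \<subseteq> {-L..L} \<times> {-K..K}" by auto
        then have finP: "finite ?P" by (rule finite_subset) simp
        have "?C \<subseteq> (\<lambda>(x, y). (g * x, g * y)) ` ?P" 
        proof
          fix z assume z: "z \<in> ?C"
          obtain X Y where XY: "z = (X, Y)" by (metis surj_pair)
          show "z \<in> (\<lambda>(x, y). (g * x, g * y)) ` ?P"
            using dec[OF z[unfolded XY]] unfolding XY by (auto intro!: image_eqI)
        qed
        then have "card ?C \<le> card ?P" using finP by (meson surj_card_le)
        then show ?thesis using P by simp
      qed
    qed (use fin cN in auto)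
    also have "\<dots> \<le> T * (T * (25 * T))" using cN by (intro mult_right_mono) auto
    finally show ?thesis by (simp add: power3_eq_cube mult_ac)
  qed
qed

text \<open>Writing D = D0 q^2 with D0 squarefree, the square part is moved into the variable: Y
  becomes q Y. Since \<bar>q\<bar> \<le> k, its bound grows from K to k K.\<close>

lemma card_norm_solutions:
  fixes D N L K M :: int
  assumes T: "divisor_bound T M" "M \<ge> 1" and D: "D \<noteq> 0" "\<bar>D\<bar> \<le> k\<^sup>2" "k \<ge> 0" and N: "N \<noteq> 0" "\<bar>N\<bar> \<le> M"
    and LK: "L \<ge> 0" "K \<ge> 0" "4 * L * (k * K) \<le> M"
  shows "card {(X, Y). X\<^sup>2 - D * Y\<^sup>2 = N \<and> \<bar>X\<bar> \<le> L \<and> \<bar>Y\<bar> \<le> K} \<le> 25 * T ^ 3"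
proof -
  let ?S = "{(X, Y). X\<^sup>2 - D * Y\<^sup>2 = N \<and> \<bar>X\<bar> \<le> L \<and> \<bar>Y\<bar> \<le> K}"
  define D0 q where "D0 = squarefree_part D" and "q = square_part D"
  have Dq: "D = D0 * q\<^sup>2" unfolding D0_def q_def by (rule squarefree_decompose)
  have sf: "squarefree D0" by (simp add: D0_def)
  have q0: "q \<noteq> 0" and D00: "D0 \<noteq> 0" using D by (auto simp: q_def D0_def)
  have "q\<^sup>2 \<le> \<bar>D0\<bar> * q\<^sup>2" using D00 mult_right_mono[of 1 "\<bar>D0\<bar>" "q\<^sup>2"] by simp
  also have "\<dots> = \<bar>D\<bar>" by (simp add: Dq abs_mult)
  finally have "q\<^sup>2 \<le> k\<^sup>2" using D by simp
  then have qk: "\<bar>q\<bar> \<le> k" using D(3) abs_le_square_iff[of q k] by simp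
  let ?S' = "{(X, Y). X\<^sup>2 - D0 * Y\<^sup>2 = N \<and> \<bar>X\<bar> \<le> L \<and> \<bar>Y\<bar> \<le> k * K}"
  have "?S' \<subseteq> {-L..L} \<times> {-(k * K)..k * K}" by auto
  then have fin: "finite ?S'" by (rule finite_subset) simp
  have "inj_on (\<lambda>(X, Y). (X, q * Y)) A" for A :: "(int \<times> int) set"
    using q0 by (auto simp: inj_on_def)
  then have "card ?S \<le> card ?S'"
  proof (rule card_inj_on_le[where f = "\<lambda>(X, Y). (X, q * Y)"])
    show "(\<lambda>(X, Y). (X, q * Y)) ` ?S \<subseteq> ?S'"
    proof clarify
      fix X Y assume XY: "\<bar>X\<bar> \<le> L" "\<bar>Y\<bar> \<le> K"
      have "\<bar>q * Y\<bar> \<le> k * K" unfolding abs_mult using qk XY LK by (intro mult_mono) auto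
      moreover have "D0 * (q * Y)\<^sup>2 = D * Y\<^sup>2" by (subst Dq) (simp add: power_mult_distrib mult_ac)
      ultimately show "X\<^sup>2 - D0 * (q * Y)\<^sup>2 = X\<^sup>2 - D * Y\<^sup>2 \<and> \<bar>X\<bar> \<le> L \<and> \<bar>q * Y\<bar> \<le> k * K"
        using XY by simp
    qed
  qed fact
  also have "\<dots> \<le> 25 * T ^ 3" using T sf N LK D(3) by (intro card_squarefree_norm_solutions) auto
  finally show ?thesis .
qed

subsection \<open>The divisor function\<close>

lemma card_divisors_prime_power_mult:
  fixes m p :: nat
  assumes "prime p" "m > 0"
  shows "card {d. d dvd p ^ a * m} \<le> (a + 1) * card {d. d dvd m}"
proof -
  have "{d. d dvd p ^ a * m} \<subseteq> (\<lambda>(i, d). p ^ i * d) ` ({..a} \<times> {d. d dvd m})"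
  proof
    fix d assume "d \<in> {d. d dvd p ^ a * m}"
    then have "d dvd p ^ a * m" by simp
    then obtain b c where bc: "d = b * c" "b dvd p ^ a" "c dvd m" using division_decomp by metis
    then obtain i where "i \<le> a" "b = p ^ i" using assms(1) divides_primepow_nat by blast
    then show "d \<in> (\<lambda>(i, d). p ^ i * d) ` ({..a} \<times> {d. d dvd m})" using bc by force
  qed
  then have "card {d. d dvd p ^ a * m} \<le> card ({..a} \<times> {d. d dvd m})"
    using assms(2) by (intro surj_card_le[where f = "\<lambda>(i, d). p ^ i * d"]) auto
  then show ?thesis by (simp add: card_cartesian_product)
qed

text \<open>Splitting off the full power p^a of a prime multiplies the number of divisors by at most
  a + 1. For p \<ge> P this is paid by a + 1 \<le> 2^a \<le> p^(\<epsilon> a). Each smaller prime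
  costs one factor C, so the exponent of C counts the small primes dividing n.\<close>

lemma card_divisors_le_powr_aux:
  fixes C \<epsilon> :: real and P n :: nat
  assumes e: "\<epsilon> > 0" and P: "\<And>p. p \<ge> P \<Longrightarrow> 2 \<le> real p powr \<epsilon>"
    and C: "C \<ge> 1" "\<And>a::nat. real a + 1 \<le> C * 2 powr (\<epsilon> * real a)" and n: "n > 0"
  shows "real (card {d. d dvd n}) \<le> C ^ card {p. prime p \<and> p dvd n \<and> p < P} * real n powr \<epsilon>"
  using n
proof (induction n rule: less_induct)
  case (less n)
  show ?case
  proof (cases "n = 1")
    case True then show ?thesis using C by auto
  next
    case False
    then obtain p where p: "prime p" "p dvd n" using prime_factor_nat by blast
    obtain m where m: "n = p ^ multiplicity p n * m" "\<not> p dvd m"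
    proof (rule multiplicity_decompose'[of n p])
      show "n \<noteq> 0" "\<not> p dvd 1" using less.prems p(1) by auto
    qed blast
    define a where "a = multiplicity p n"
    have nm: "n = p ^ a * m" using m by (simp add: a_def)
    have m0: "m > 0" using less.prems m(1) by (auto intro: Nat.gr0I)
    have a0: "a > 0" using p(2) m(2) nm by (cases a) auto
    have p2: "p \<ge> 2" using p(1) prime_ge_2_nat by blast
    have "1 < p ^ a" using p2 a0 by (intro one_less_power) auto
    then have mn: "m < n" using m0 by (simp add: nm)
    define S where "S = {q. prime q \<and> q dvd m \<and> q < P}"
    define S' where "S' = {q. prime q \<and> q dvd n \<and> q < P}"
    have finS: "finite S" "finite S'" by (auto simp: S_def S'_def)
    have sub: "S \<subseteq> S'" "p \<notin> S" using m(2) by (auto simp: S_def S'_def nm)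
    have IH: "real (card {d. d dvd m}) \<le> C ^ card S * real m powr \<epsilon>"
      unfolding S_def by (rule less.IH[OF mn m0])
    have pa: "(real p powr \<epsilon>) ^ a = real (p ^ a) powr \<epsilon>"
      using p2 by (simp add: powr_powr powr_realpow[symmetric] mult.commute)
    have step: "(real a + 1) * C ^ card S \<le> C ^ card S' * (real p powr \<epsilon>) ^ a"
    proof (cases "p < P")
      case True
      have "Suc (card S) = card (insert p S)" using finS sub by simp
      also have "\<dots> \<le> card S'" using finS sub True p by (intro card_mono) (auto simp: S'_def)
      finally have "C ^ Suc (card S) \<le> C ^ card S'" using C by (intro power_increasing) auto
      moreover have "2 powr (\<epsilon> * real a) \<le> (real p powr \<epsilon>) ^ a"
      proof -
        have "2 powr (\<epsilon> * real a) = (2 powr \<epsilon>) ^ a" by (simp add: powr_powr powr_realpow[symmetric])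
        also have "\<dots> \<le> (real p powr \<epsilon>) ^ a" using p2 e by (intro power_mono powr_mono2) auto
        finally show ?thesis .
      qed
      ultimately have "C ^ Suc (card S) * 2 powr (\<epsilon> * real a) \<le> C ^ card S' * (real p powr \<epsilon>) ^ a"
        using C by (intro mult_mono) auto
      moreover have "(real a + 1) * C ^ card S \<le> C * 2 powr (\<epsilon> * real a) * C ^ card S"
        using C by (intro mult_right_mono) auto
      ultimately show ?thesis by (simp add: mult_ac)
    next
      case False
      have "real a + 1 \<le> 2 ^ a" using of_nat_mono[OF Suc_leI[OF less_exp[of a]], where ?'a = real] by simp
      also have "\<dots> \<le> (real p powr \<epsilon>) ^ a" using P False by (intro power_mono) auto
      finally have "real a + 1 \<le> (real p powr \<epsilon>) ^ a" .
      moreover have "C ^ card S \<le> C ^ card S'" using C finS sub by (intro power_increasing card_mono) auto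
      ultimately have "(real a + 1) * C ^ card S \<le> (real p powr \<epsilon>) ^ a * C ^ card S'"
        using C by (intro mult_mono) auto
      then show ?thesis by (simp add: mult.commute)
    qed
    have "card {d. d dvd n} \<le> (a + 1) * card {d. d dvd m}"
      unfolding nm using p(1) m0 by (rule card_divisors_prime_power_mult)
    then have "real (card {d. d dvd n}) \<le> (real a + 1) * real (card {d. d dvd m})"
      using of_nat_mono[of "card {d. d dvd n}" "(a + 1) * card {d. d dvd m}", where ?'a = real] by (simp add: distrib_right)
    also have "\<dots> \<le> (real a + 1) * (C ^ card S * real m powr \<epsilon>)" using IH by (intro mult_left_mono) auto
    also have "\<dots> = ((real a + 1) * C ^ card S) * real m powr \<epsilon>" by simp
    also have "\<dots> \<le> (C ^ card S' * (real p powr \<epsilon>) ^ a) * real m powr \<epsilon>" using step by (intro mult_right_mono) auto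
    also have "\<dots> = C ^ card S' * real n powr \<epsilon>" unfolding pa by (simp add: nm powr_mult)
    finally show ?thesis by (simp add: S'_def)
  qed
qed

lemma card_divisors_le_powr:
  fixes \<epsilon> :: real
  assumes e: "\<epsilon> > 0"
  shows "\<exists>C\<ge>1. \<forall>n>0. real (card {d. d dvd n}) \<le> C * real n powr \<epsilon>"
proof -
  define P where "P = nat \<lceil>2 powr (1 / \<epsilon>)\<rceil>"
  have P: "2 \<le> real p powr \<epsilon>" if "p \<ge> P" for p
  proof -
    have "2 powr (1 / \<epsilon>) \<le> real p" using that unfolding P_def by linarith
    then have "(2 powr (1 / \<epsilon>)) powr \<epsilon> \<le> real p powr \<epsilon>" using e by (intro powr_mono2) auto
    then show ?thesis using e by (simp add: powr_powr)
  qed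
  \<comment> \<open>With t = \<epsilon> a ln 2, the number a + 1 equals 1 + t / (\<epsilon> ln 2),
    and both 1 and t are at most exp t = 2^(\<epsilon> a).\<close>
  define C where "C = 1 + 1 / (\<epsilon> * ln 2)"
  have C1: "C \<ge> 1" using e by (simp add: C_def)
  have C: "real a + 1 \<le> C * 2 powr (\<epsilon> * real a)" for a :: nat
  proof -
    define t where "t = \<epsilon> * real a * ln 2"
    have "1 + t \<le> exp t" by (rule exp_ge_add_one_self)
    moreover have "t \<ge> 0" using e by (simp add: t_def)
    moreover have "exp t = 2 powr (\<epsilon> * real a)" by (simp add: powr_def t_def)
    moreover have "real a + 1 = 1 + t / (\<epsilon> * ln 2)" using e by (simp add: t_def)
    moreover have "t / (\<epsilon> * ln 2) \<le> exp t / (\<epsilon> * ln 2)"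
    proof (rule divide_right_mono)
      show "t \<le> exp t" using exp_ge_add_one_self[of t] by linarith
    qed (use e in simp)
    ultimately have "real a + 1 \<le> exp t + exp t / (\<epsilon> * ln 2)" "exp t = 2 powr (\<epsilon> * real a)"
      by linarith+
    then show ?thesis by (simp add: C_def distrib_right)
  qed
  have "real (card {d. d dvd n}) \<le> C ^ P * real n powr \<epsilon>" if "n > 0" for n
  proof -
    have "card {p. prime p \<and> p dvd n \<and> p < P} \<le> card {..<P}" by (intro card_mono) auto
    then have "C ^ card {p. prime p \<and> p dvd n \<and> p < P} \<le> C ^ P" using C1 by (intro power_increasing) auto
    then show ?thesis using card_divisors_le_powr_aux[OF e P C1 C that]
      by (meson order_trans mult_right_mono powr_ge_zero)
  qed
  moreover have "C ^ P \<ge> 1" using C1 by (rule one_le_power)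
  ultimately show ?thesis by blast
qed

lemma card_int_divisors_le:
  fixes n :: int
  assumes "n \<noteq> 0"
  shows "card {d. d dvd n} \<le> 2 * card {d. d dvd nat \<bar>n\<bar>}"
proof -
  let ?A = "{d. d dvd nat \<bar>n\<bar>}"
  have fin: "finite ?A" using assms by (intro finite_divisors_nat) auto
  have "{d. d dvd n} \<subseteq> int ` ?A \<union> (\<lambda>d. - int d) ` ?A"
  proof
    fix d assume "d \<in> {d. d dvd n}"
    then have "nat \<bar>d\<bar> \<in> ?A" by (simp add: nat_abs_dvd_iff)
    moreover have "d = int (nat \<bar>d\<bar>) \<or> d = - int (nat \<bar>d\<bar>)" by linarith
    ultimately show "d \<in> int ` ?A \<union> (\<lambda>d. - int d) ` ?A" by blast
  qed
  then have "card {d. d dvd n} \<le> card (int ` ?A \<union> (\<lambda>d. - int d) ` ?A)" using fin by (intro card_mono) auto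
  also have "\<dots> \<le> card (int ` ?A) + card ((\<lambda>d. - int d) ` ?A)" by (rule card_Un_le)
  also have "\<dots> \<le> card ?A + card ?A" using fin by (intro add_mono card_image_le)
  finally show ?thesis by simp
qed

lemma divisor_bound_powr:
  fixes \<epsilon> :: real
  assumes e: "\<epsilon> > 0"
  shows "\<exists>C\<ge>1. \<forall>M\<ge>1. \<exists>T. divisor_bound T M \<and> real T \<le> C * real_of_int M powr \<epsilon>"
proof -
  obtain C where C: "C \<ge> 1" "\<And>n. n > 0 \<Longrightarrow> real (card {d. d dvd n}) \<le> C * real n powr \<epsilon>"
    using card_divisors_le_powr[OF e] by blast
  have "\<exists>T. divisor_bound T M \<and> real T \<le> 2 * C * real_of_int M powr \<epsilon>" if M: "M \<ge> 1" for M
  proof (intro exI conjI)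
    let ?T = "nat \<lfloor>2 * C * real_of_int M powr \<epsilon>\<rfloor>"
    show "real ?T \<le> 2 * C * real_of_int M powr \<epsilon>" using C by (simp add: mult_nonneg_nonneg)
    show "divisor_bound ?T M" unfolding divisor_bound_def
    proof (intro allI impI, elim conjE)
      fix n :: int assume n: "n \<noteq> 0" "\<bar>n\<bar> \<le> M"
      have "real (card {d. d dvd n}) \<le> 2 * real (card {d. d dvd nat \<bar>n\<bar>})"
        using card_int_divisors_le[OF n(1)] by linarith
      also have "\<dots> \<le> 2 * (C * real (nat \<bar>n\<bar>) powr \<epsilon>)" using C(2)[of "nat \<bar>n\<bar>"] n by simp
      also have "\<dots> \<le> 2 * (C * real_of_int M powr \<epsilon>)"
        using n e C(1) by (intro mult_left_mono powr_mono2) auto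
      finally have "real (card {d. d dvd n}) \<le> 2 * C * real_of_int M powr \<epsilon>" by simp
      then show "card {d. d dvd n} \<le> ?T" by (simp add: le_nat_floor)
    qed
  qed
  moreover have "2 * C \<ge> 1" using C by simp
  ultimately show ?thesis by blast
qed

subsection \<open>Counting bordered matrices\<close>

text \<open>Finiteness is part of the notion because \<open>card\<close> is 0 on infinite sets; with
  it the bound passes to subsets, images and unions.\<close>

definition at_most :: "nat \<Rightarrow> 'a set \<Rightarrow> bool" where
  "at_most n S \<longleftrightarrow> finite S \<and> card S \<le> n"

lemma at_most_subset: "at_most n A \<Longrightarrow> S \<subseteq> A \<Longrightarrow> at_most n S"
  unfolding at_most_def by (meson card_mono finite_subset le_trans)

lemma at_most_mono: "at_most k S \<Longrightarrow> k \<le> n \<Longrightarrow> at_most n S"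
  by (auto simp: at_most_def)

lemma at_most_empty [simp]: "at_most n {}"
  by (simp add: at_most_def)

lemma at_most_if_nonempty: "(S \<noteq> {} \<Longrightarrow> at_most n S) \<Longrightarrow> at_most n S"
  by (cases "S = {}") auto

lemma at_most_inj_on: "at_most n A \<Longrightarrow> f ` S \<subseteq> A \<Longrightarrow> inj_on f S \<Longrightarrow> at_most n S"
  unfolding at_most_def by (meson card_inj_on_le inj_on_finite le_trans)

lemma at_most_image: "at_most n A \<Longrightarrow> at_most n (f ` A)"
  unfolding at_most_def by (meson card_image_le finite_imageI le_trans)

lemma at_most_Un: "at_most k A \<Longrightarrow> at_most n B \<Longrightarrow> at_most (k + n) (A \<union> B)"
  unfolding at_most_def by (meson add_mono card_Un_le finite_UnI le_trans)

lemma at_most_Sigma: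
  assumes "at_most k A" "\<And>a. a \<in> A \<Longrightarrow> at_most n (F a)"
  shows "at_most (k * n) (Sigma A F)"
proof -
  have fin: "finite A" "\<And>a. a \<in> A \<Longrightarrow> finite (F a)" using assms by (auto simp: at_most_def)
  have "card (Sigma A F) = (\<Sum>a\<in>A. card (F a))" using fin by (intro card_SigmaI) auto
  also have "\<dots> \<le> card A * n" using assms sum_bounded_above[of A "\<lambda>a. card (F a)" n] by (auto simp: at_most_def)
  also have "\<dots> \<le> k * n" using assms by (intro mult_right_mono) (auto simp: at_most_def)
  finally show ?thesis using fin by (auto simp: at_most_def)
qed

lemma at_most_UN:
  assumes "at_most k A" "\<And>a. a \<in> A \<Longrightarrow> at_most n (F a)"
  shows "at_most (k * n) (\<Union>a\<in>A. F a)"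
proof -
  have "(\<Union>a\<in>A. F a) = snd ` Sigma A F" by force
  then show ?thesis using at_most_image[OF at_most_Sigma[OF assms]] by simp
qed

lemma at_most_fibers:
  assumes "at_most k A" "f ` S \<subseteq> A" "\<And>y. y \<in> A \<Longrightarrow> at_most n {x \<in> S. f x = y}"
  shows "at_most (k * n) S"
proof (rule at_most_inj_on[OF at_most_Sigma[OF assms(1,3)], where f = "\<lambda>x. (f x, x)"])
  show "(\<lambda>x. (f x, x)) ` S \<subseteq> Sigma A (\<lambda>a. {x \<in> S. f x = a})" using assms(2) by auto
qed (auto intro: inj_onI)

lemma integer_roots_cubic: "at_most 3 {\<nu>::int. \<nu> ^ 3 - t * \<nu>\<^sup>2 + s * \<nu> - p = 0}"
proof -
  let ?q = "[:- p, s, - t, 1:]"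
  have "{\<nu>::int. \<nu> ^ 3 - t * \<nu>\<^sup>2 + s * \<nu> - p = 0} = {\<nu>. poly ?q \<nu> = 0}"
    by (auto simp: algebra_simps power2_eq_square power3_eq_cube)
  moreover have "card {\<nu>. poly ?q \<nu> = 0} \<le> degree ?q" by (rule card_poly_roots_bound) simp
  moreover have "finite {\<nu>. poly ?q \<nu> = 0}" by (rule poly_roots_finite) simp
  ultimately show ?thesis by (simp add: at_most_def)
qed

lemma product_solutions:
  assumes "divisor_bound T M" "k \<noteq> 0" "\<bar>k\<bar> \<le> M"
  shows "at_most T {(b, c). b * c = (k::int)}"
proof (rule at_most_inj_on[where A = "{d. d dvd k}" and f = fst])
  show "at_most T {d. d dvd k}" using assms by (auto simp: at_most_def intro: divisor_boundD)
  show "inj_on fst {(b, c). b * c = k}" using assms(2) by (auto simp: inj_on_def)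
qed auto

text \<open>The exponent 6 comes from the product of two binary forms, each at most 4 h^3 in
  absolute value. The constant 256 covers this 16 h^6 and also the 48 h^4 required by the norm
  equations.\<close>

locale height =
  fixes h M :: int and T :: nat
  assumes h: "h \<ge> 1" and T: "divisor_bound T M" and M: "256 * h ^ 6 \<le> M"
begin

definition m :: nat where "m = nat (2 * h + 1)"

abbreviation box :: "int set" where "box \<equiv> {- h..h}"

lemma box: "at_most m box"
  using h by (simp add: at_most_def m_def)

lemma box2: "at_most (m * m) (box \<times> box)"
  by (intro at_most_Sigma box)

lemma m_ge_1: "m \<ge> 1" using h by (simp add: m_def)

lemma pow_le_M:
  assumes "i \<le> 6" "q \<le> 256"
  shows "q * h ^ i \<le> M"
proof -
  have "q * h ^ i \<le> 256 * h ^ 6" using h assms by (intro mult_mono power_increasing) auto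
  then show ?thesis using M by linarith
qed

lemma M_ge_1: "M \<ge> 1"
  using pow_le_M[of 0 1] by simp

lemma T_ge_1: "T \<ge> 1"
  using divisor_bound_ge_1[OF T M_ge_1] .

text \<open>Bounds are kept in the form c h^i, so that those of factors combine by multiplying
  constants and adding exponents. This explains unsimplified bounds such as (1 * (1 * 1)) * h ^ (1 +
  (1 + 1)) below.\<close>

lemma abs_mult_le: "\<bar>x\<bar> \<le> c * h ^ i \<Longrightarrow> \<bar>y\<bar> \<le> d * h ^ j \<Longrightarrow> 0 \<le> c \<Longrightarrow> \<bar>x * y\<bar> \<le> (c * d) * h ^ (i + j)"
  using h mult_mono[of "\<bar>x\<bar>" "c * h ^ i" "\<bar>y\<bar>" "d * h ^ j"] by (simp add: abs_mult power_add mult_ac)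

lemma line_solutions:
  assumes "r \<noteq> 0 \<or> q \<noteq> 0"
  shows "at_most m {(x, y). x \<in> box \<and> y \<in> box \<and> r * x + q * y = k}"
proof (cases "q = 0")
  case True
  show ?thesis
    by (rule at_most_inj_on[OF box, where f = snd]) (use True assms in \<open>auto simp: inj_on_def\<close>)
next
  case False
  show ?thesis
  proof (rule at_most_inj_on[OF box, where f = fst])
    show "inj_on fst {(x, y). x \<in> box \<and> y \<in> box \<and> r * x + q * y = k}"
    proof (rule inj_onI)
      fix u u' assume u: "u \<in> {(x, y). x \<in> box \<and> y \<in> box \<and> r * x + q * y = k}"
        "u' \<in> {(x, y). x \<in> box \<and> y \<in> box \<and> r * x + q * y = k}" "fst u = fst u'"
      then have "r * fst u + q * snd u = k" "r * fst u + q * snd u' = k" by auto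
      then have "q * snd u = q * snd u'" by linarith
      then show "u = u'" using u(3) False by (simp add: prod_eq_iff)
    qed
  qed auto
qed

lemma zero_product_solutions: "at_most (2 * m) {(b, c). b \<in> box \<and> c \<in> box \<and> b * c = 0}"
proof -
  have "at_most (1 * m + m * 1) ({0} \<times> box \<union> box \<times> {0})"
    by (intro at_most_Un at_most_Sigma box) (auto simp: at_most_def)
  then show ?thesis by (rule at_most_subset[OF at_most_mono]) auto
qed

text \<open>No bound on k is assumed: a single pair (b, c) in the box shows \<bar>k\<bar> \<le> h^2.
  For k = 0 one factor is free, whence the factor 2 m.\<close>

lemma box_product_solutions: "at_most (2 * m * T) {(b, c). b \<in> box \<and> c \<in> box \<and> b * c = k}"
proof (cases "k = 0")
  case True
  then show ?thesis using zero_product_solutions T_ge_1 by (auto elim!: at_most_mono)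
next
  case False
  show ?thesis
  proof (rule at_most_if_nonempty)
    assume "{(b, c). b \<in> box \<and> c \<in> box \<and> b * c = k} \<noteq> {}"
    then obtain b c where "b \<in> box" "c \<in> box" "b * c = k" by blast
    then have bc: "\<bar>b\<bar> \<le> h" "\<bar>c\<bar> \<le> h" "b * c = k" by auto
    have "\<bar>k\<bar> \<le> 1 * 1 * h ^ (1 + 1)" unfolding bc(3)[symmetric] using bc by (intro abs_mult_le) auto
    then have "\<bar>k\<bar> \<le> M" using pow_le_M[of 2 1] by (simp add: numeral_2_eq_2)
    then have "at_most T {(b, c). b * c = k}" using False T by (intro product_solutions)
    moreover have "T \<le> 2 * m * T" using m_ge_1 by simp
    ultimately show "at_most (2 * m * T) {(b, c). b \<in> box \<and> c \<in> box \<and> b * c = k}"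
      by (auto elim!: at_most_subset[OF at_most_mono])
  qed
qed

text \<open>Multiplication by 4 c completes the square: (2 c x + (d - a) y)^2 - D y^2 = 4 c k. If c
  = 0 the form is y ((d - a) x - b y), so y divides k and then determines x.\<close>

lemma form_solutions:
  assumes abcd: "\<bar>a\<bar> \<le> h" "\<bar>b\<bar> \<le> h" "\<bar>c\<bar> \<le> h" "\<bar>d\<bar> \<le> h"
    and D: "(d - a)\<^sup>2 + 4 * b * c \<noteq> 0" and k: "k \<noteq> 0"
  shows "at_most (25 * T ^ 3) {(x, y). x \<in> box \<and> y \<in> box \<and> c * x\<^sup>2 + (d - a) * x * y - b * y\<^sup>2 = k}"
    (is "at_most _ ?S")
proof (rule at_most_if_nonempty)
  assume "?S \<noteq> {}"
  then obtain x y where "x \<in> box" "y \<in> box" "c * x\<^sup>2 + (d - a) * x * y - b * y\<^sup>2 = k" by blast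
  then have xy: "\<bar>x\<bar> \<le> h" "\<bar>y\<bar> \<le> h" "c * x\<^sup>2 + (d - a) * x * y - b * y\<^sup>2 = k" by auto
  have da: "\<bar>d - a\<bar> \<le> 2 * h ^ 1" using abcd by simp
  have b1: "\<bar>c * (x * x)\<bar> \<le> (1 * (1 * 1)) * h ^ (1 + (1 + 1))"
    "\<bar>(d - a) * (x * y)\<bar> \<le> (2 * (1 * 1)) * h ^ (1 + (1 + 1))"
    "\<bar>b * (y * y)\<bar> \<le> (1 * (1 * 1)) * h ^ (1 + (1 + 1))"
    using xy abcd da by (intro abs_mult_le; simp)+
  have "k = c * (x * x) + (d - a) * (x * y) - b * (y * y)" using xy(3) by (simp add: power2_eq_square)
  then have kb: "\<bar>k\<bar> \<le> 4 * h ^ 3" using b1 by (simp add: eval_nat_numeral)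
  have "\<bar>(4 * c) * k\<bar> \<le> (4 * 4) * h ^ (1 + 3)" using kb abcd by (intro abs_mult_le) (auto simp: abs_mult)
  then have ckM: "\<bar>4 * c * k\<bar> \<le> M" using pow_le_M[of 4 16] by simp
  have kM: "\<bar>k\<bar> \<le> M" using kb pow_le_M[of 3 4] by simp
  show "at_most (25 * T ^ 3) ?S"
  proof (cases "c = 0")
    case True
    then have da0: "d \<noteq> a" using D by auto
    have "at_most T ?S"
    proof (rule at_most_inj_on[where A = "{e. e dvd k}" and f = snd])
      show "at_most T {e. e dvd k}" using T k kM by (auto simp: at_most_def intro: divisor_boundD)
      show "snd ` ?S \<subseteq> {e. e dvd k}"
      proof clarsimp
        fix x y
        have "c * x\<^sup>2 + (d - a) * x * y - b * y\<^sup>2 = y * ((d - a) * x - b * y)"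
          using True by (simp add: algebra_simps power2_eq_square)
        then show "y dvd c * x\<^sup>2 + (d - a) * x * y - b * y\<^sup>2" by simp
      qed
      show "inj_on snd ?S"
      proof (rule inj_onI)
        fix u u' assume u: "u \<in> ?S" "u' \<in> ?S" "snd u = snd u'"
        obtain x y x' where uu: "u = (x, y)" "u' = (x', y)" using u(3) by (metis prod.collapse)
        have e: "(d - a) * x * y - b * y\<^sup>2 = k" "(d - a) * x' * y - b * y\<^sup>2 = k" using u True by (auto simp: uu)
        have "y \<noteq> 0" using e k by auto
        moreover have "(d - a) * x * y = (d - a) * x' * y" using e by linarith
        ultimately show "u = u'" using da0 by (simp add: uu)
      qed
    qed
    moreover have "T * 1 \<le> T * (25 * T\<^sup>2)" using T_ge_1 by (intro mult_left_mono) auto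
    ultimately show ?thesis by (elim at_most_mono) (simp add: power3_eq_cube power2_eq_square)
  next
    case False
    define D where "D = (d - a)\<^sup>2 + 4 * b * c"
    let ?A = "{(X, Y). X\<^sup>2 - D * Y\<^sup>2 = 4 * c * k \<and> \<bar>X\<bar> \<le> 4 * h\<^sup>2 \<and> \<bar>Y\<bar> \<le> h}"
    have Db: "\<bar>D\<bar> \<le> (3 * h)\<^sup>2"
    proof -
      have "\<bar>(d - a) * (d - a)\<bar> \<le> (2 * 2) * h ^ (1 + 1)" "\<bar>(4 * b) * c\<bar> \<le> (4 * 1) * h ^ (1 + 1)"
        using da abcd by (intro abs_mult_le; simp add: abs_mult)+
      moreover have "D = (d - a) * (d - a) + (4 * b) * c" by (simp add: D_def power2_eq_square)
      ultimately have "\<bar>D\<bar> \<le> (2 * 2) * h ^ (1 + 1) + (4 * 1) * h ^ (1 + 1)"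
        using abs_triangle_ineq[of "(d - a) * (d - a)" "(4 * b) * c"] by linarith
      then have "\<bar>D\<bar> \<le> 8 * h\<^sup>2" by (simp add: numeral_2_eq_2)
      moreover have "h\<^sup>2 \<ge> 0" by simp
      ultimately show ?thesis by (simp add: power_mult_distrib)
    qed
    show ?thesis
    proof (rule at_most_inj_on[where A = ?A and f = "\<lambda>(x, y). (2 * c * x + (d - a) * y, y)"])
      have "?A \<subseteq> {- (4 * h\<^sup>2)..4 * h\<^sup>2} \<times> box" by auto
      then have "finite ?A" by (rule finite_subset) simp
      \<comment> \<open>With L = 4 h^2, k = 3 h and K = h the required product 4 L k K is 48 h^4;
        the choice of k uses \<bar>D\<bar> \<le> 8 h^2.\<close>
      moreover have "card ?A \<le> 25 * T ^ 3"
        using T M_ge_1 \<open>(d - a)\<^sup>2 + 4 * b * c \<noteq> 0\<close> Db False k ckM h pow_le_M[of 4 48]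
        by (intro card_norm_solutions[where k = "3 * h" and M = M])
          (auto simp: D_def power2_eq_square eval_nat_numeral)
      ultimately show "at_most (25 * T ^ 3) ?A" by (simp add: at_most_def)
      show "inj_on (\<lambda>(x, y). (2 * c * x + (d - a) * y, y)) ?S" using False by (auto simp: inj_on_def)
      show "(\<lambda>(x, y). (2 * c * x + (d - a) * y, y)) ` ?S \<subseteq> ?A"
      proof (rule image_subsetI)
        fix u assume u: "u \<in> ?S"
        obtain x y where uu: "u = (x, y)" by (metis surj_pair)
        have xy: "\<bar>x\<bar> \<le> h" "\<bar>y\<bar> \<le> h" "c * x\<^sup>2 + (d - a) * x * y - b * y\<^sup>2 = k" using u by (auto simp: uu abs_le_iff)
        have "\<bar>(2 * c) * x\<bar> \<le> (2 * 1) * h ^ (1 + 1)" "\<bar>(d - a) * y\<bar> \<le> (2 * 1) * h ^ (1 + 1)"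
          using xy abcd da by (intro abs_mult_le; simp add: abs_mult)+
        then have "\<bar>2 * c * x + (d - a) * y\<bar> \<le> 4 * h\<^sup>2" by (simp add: numeral_2_eq_2)
        moreover have "(2 * c * x + (d - a) * y)\<^sup>2 - D * y\<^sup>2 = 4 * c * k"
          unfolding D_def xy(3)[symmetric] by (simp add: algebra_simps power2_eq_square)
        ultimately show "(case u of (x, y) \<Rightarrow> (2 * c * x + (d - a) * y, y)) \<in> ?A" using xy by (simp add: uu)
      qed
    qed
  qed
qed


section \<open>Triples of a block, a column and a row\<close>

abbreviation boxes :: "(int \<times> int \<times> int \<times> int) set" where
  "boxes \<equiv> box \<times> box \<times> box \<times> box"

lemma boxes: "at_most (m * (m * (m * m))) boxes"
  by (intro at_most_Sigma box)

text \<open>An element \<open>((a, b, c, d), (x, y), (z, w))\<close> of the following set encodes the integer matrix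
  with rows \<open>(a, b, x)\<close>, \<open>(c, d, y)\<close>, \<open>(z, w, e)\<close>, where \<open>e\<close> is chosen so that the trace is \<open>t\<close>;
  the two equations say that the other coefficients of its characteristic polynomial are \<open>s\<close> and \<open>- p\<close>.\<close>

definition sols :: "int \<Rightarrow> int \<Rightarrow> int \<Rightarrow> ((int \<times> int \<times> int \<times> int) \<times> (int \<times> int) \<times> (int \<times> int)) set" where
  "sols t s p = {((a, b, c, d), (x, y), (z, w)).
     (a, b, c, d) \<in> boxes \<and> (x, y) \<in> box \<times> box \<and> (z, w) \<in> box \<times> box \<and>
     z * x + w * y = (t - a - d) * (a + d) + (a * d - b * c) - s \<and>
     z * (d * x - b * y) + w * (a * y - c * x) = (t - a - d) * (a * d - b * c) - p}"

lemma solsD: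
  assumes "((a, b, c, d), (x, y), (z, w)) \<in> sols t s p"
  shows "\<bar>a\<bar> \<le> h" "\<bar>b\<bar> \<le> h" "\<bar>c\<bar> \<le> h" "\<bar>d\<bar> \<le> h" "\<bar>x\<bar> \<le> h" "\<bar>y\<bar> \<le> h" "\<bar>z\<bar> \<le> h" "\<bar>w\<bar> \<le> h"
    and "z * x + w * y = (t - a - d) * (a + d) + (a * d - b * c) - s"
    and "z * (d * x - b * y) + w * (a * y - c * x) = (t - a - d) * (a * d - b * c) - p"
  using assms by (auto simp: sols_def abs_le_iff)

text \<open>This is det(u, B u), which vanishes exactly if u is zero or an eigenvector of B. Its
  discriminant (d - a)^2 + 4 b c is that of the characteristic polynomial of B.\<close>

definition eigform :: "int \<times> int \<times> int \<times> int \<Rightarrow> int \<times> int \<Rightarrow> int" where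
  "eigform B u = (case B of (a, b, c, d) \<Rightarrow> case u of (x, y) \<Rightarrow> c * x\<^sup>2 + (d - a) * x * y - b * y\<^sup>2)"

definition block_transpose :: "int \<times> int \<times> int \<times> int \<Rightarrow> int \<times> int \<times> int \<times> int" where
  "block_transpose B = (case B of (a, b, c, d) \<Rightarrow> (a, c, b, d))"

text \<open>For u = 0 the matrix is block triangular and its corner entry e is one of at most 3
  roots of f. With e, a and v chosen, the trace gives d and the coefficient s gives b c, so (b, c)
  has at most 2 m T values.\<close>

lemma zero_vector_solutions:
  "at_most (6 * m ^ 4 * T) {(B, u, v). (B, u, v) \<in> sols t s p \<and> u = (0, 0)}" (is "at_most _ ?S")
proof -
  let ?R = "{\<nu>::int. \<nu> ^ 3 - t * \<nu>\<^sup>2 + s * \<nu> - p = 0}"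
  let ?F = "\<lambda>(e, a, v). {(b, c). b \<in> box \<and> c \<in> box \<and> b * c = a * (t - e - a) - (s - e * (t - e))}"
  let ?f = "\<lambda>((e, a, v), (b, c)). ((a, b, c, t - e - a), (0, 0), v)"
  have "at_most (3 * (m * (m * m)) * (2 * m * T)) (Sigma (?R \<times> box \<times> box \<times> box) ?F)"
  proof (rule at_most_Sigma)
    show "at_most (3 * (m * (m * m))) (?R \<times> box \<times> box \<times> box)"
      by (intro at_most_Sigma integer_roots_cubic box)
    fix q :: "int \<times> int \<times> int \<times> int"
    show "at_most (2 * m * T) (?F q)"
      by (cases q) (simp only: prod.case box_product_solutions)
  qed
  then have "at_most (3 * (m * (m * m)) * (2 * m * T)) (?f ` Sigma (?R \<times> box \<times> box \<times> box) ?F)"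
    by (rule at_most_image)
  moreover have "?S \<subseteq> ?f ` Sigma (?R \<times> box \<times> box \<times> box) ?F"
  proof
    fix q assume q: "q \<in> ?S"
    obtain a b c d x y z w where qq: "q = ((a, b, c, d), (x, y), (z, w))" by (metis surj_pair)
    have xy: "x = 0" "y = 0" and sol: "((a, b, c, d), (x, y), (z, w)) \<in> sols t s p" using q by (auto simp: qq)
    note S = solsD[OF sol]
    define e where "e = t - a - d"
    have d: "d = t - e - a" by (simp add: e_def)
    have 1: "e * (t - e) + (a * d - b * c) = s" using S(9) xy by (simp add: e_def algebra_simps)
    have 2: "e * (a * d - b * c) = p" using S(10) xy by (simp add: e_def)
    have "e ^ 3 - t * e\<^sup>2 + s * e - p = 0"
      unfolding 1[symmetric] 2[symmetric] by (simp add: algebra_simps power2_eq_square power3_eq_cube)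
    moreover have "b * c = a * (t - e - a) - (s - e * (t - e))" using 1 by (simp add: d[symmetric])
    ultimately have "((e, a, (z, w)), (b, c)) \<in> Sigma (?R \<times> box \<times> box \<times> box) ?F"
      using S by (auto simp: abs_le_iff)
    moreover have "q = ?f ((e, a, (z, w)), (b, c))" by (simp add: qq xy e_def)
    ultimately show "q \<in> ?f ` Sigma (?R \<times> box \<times> box \<times> box) ?F" by blast
  qed
  ultimately show ?thesis
    by (rule at_most_mono[OF at_most_subset]) (simp add: eval_nat_numeral algebra_simps)
qed

text \<open>Dividing u by the gcd of its entries gives a primitive (x', y') with x' (c x' + d y') =
  y' (a x' + b y'). Coprimality makes x' divide a x' + b y', and the quotient is the eigenvalue,
  except that for x' = 0 the eigenvalue is d.\<close>

lemma integral_eigenvalue: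
  fixes a b c d x y :: int
  assumes "(x, y) \<noteq> (0, 0)" "c * x\<^sup>2 + (d - a) * x * y - b * y\<^sup>2 = 0"
  obtains l where "a * x + b * y = l * x" "c * x + d * y = l * y"
proof -
  define g where "g = gcd x y"
  have g0: "g \<noteq> 0" using assms(1) by (auto simp: g_def)
  obtain x' y' where xy: "x = g * x'" "y = g * y'" "coprime x' y'"
    using gcd_coprime_exists[of x y] g0 unfolding g_def by (metis mult.commute)
  have "g\<^sup>2 * (c * x'\<^sup>2 + (d - a) * x' * y' - b * y'\<^sup>2) = 0"
    using assms(2) by (simp add: xy algebra_simps power2_eq_square)
  then have "c * x'\<^sup>2 + (d - a) * x' * y' - b * y'\<^sup>2 = 0" using g0 by simp
  then have E: "x' * (c * x' + d * y') = y' * (a * x' + b * y')" by (simp add: algebra_simps power2_eq_square)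
  then have "x' dvd y' * (a * x' + b * y')" by (metis dvd_triv_left)
  then have "x' dvd a * x' + b * y'" using xy(3) by (simp add: coprime_dvd_mult_right_iff)
  then obtain l where l: "a * x' + b * y' = x' * l" by blast
  show ?thesis
  proof (cases "x' = 0")
    case True
    then have "y' \<noteq> 0" "b = 0" using xy(3) l by auto
    then show ?thesis using that[of d] True xy by simp
  next
    case False
    have "x' * (c * x' + d * y') = x' * (y' * l)" using E l by (simp add: mult_ac)
    then have l': "c * x' + d * y' = y' * l" using False by simp
    have "a * x + b * y = g * (a * x' + b * y')" "c * x + d * y = g * (c * x' + d * y')"
      by (simp_all add: xy algebra_simps)
    then show ?thesis unfolding l l' by (intro that[of l]) (simp_all add: xy)
  qed
qed

text \<open>If b c = 0, there are 2 m choices for (b, c) and 2 m for (a, d). If not, (a - \<nu>, d -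
  \<nu>) is one of T factorizations of b c. The size of \<nu> does not enter, since only b c must be
  bounded.\<close>

lemma matrices_with_eigenvalue:
  "at_most (5 * m ^ 2 * T) {(a, b, c, d). (a, b, c, d) \<in> boxes \<and> (a - \<nu>) * (d - \<nu>) = b * c}" (is "at_most _ ?S")
proof -
  let ?f = "\<lambda>((b, c), (a, d)). (a, b, c, d)"
  let ?Z = "{(b, c). b \<in> box \<and> c \<in> box \<and> b * c = 0}"
  have "at_most (2 * m * (2 * m)) (Sigma ?Z (\<lambda>_. {(a, d). a \<in> box \<and> d \<in> box \<and> (a - \<nu>) * (d - \<nu>) = 0}))"
  proof (rule at_most_Sigma[OF zero_product_solutions])
    have "at_most (1 * m + m * 1) ({\<nu>} \<times> box \<union> box \<times> {\<nu>})"
      by (intro at_most_Un at_most_Sigma box) (auto simp: at_most_def)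
    then show "at_most (2 * m) {(a, d). a \<in> box \<and> d \<in> box \<and> (a - \<nu>) * (d - \<nu>) = 0}"
      by (rule at_most_subset[OF at_most_mono]) auto
  qed
  moreover have "at_most (m * m * T) (Sigma (box \<times> box - ?Z) (\<lambda>(b, c). {(a, d). (a - \<nu>) * (d - \<nu>) = b * c}))"
  proof (rule at_most_Sigma)
    show "at_most (m * m) (box \<times> box - ?Z)" using box2 by (rule at_most_subset) auto
    fix u assume u: "u \<in> box \<times> box - ?Z"
    obtain b c where uu: "u = (b, c)" by (metis surj_pair)
    have bc: "\<bar>b\<bar> \<le> h" "\<bar>c\<bar> \<le> h" "b * c \<noteq> 0" using u by (auto simp: uu abs_le_iff)
    have "\<bar>b * c\<bar> \<le> 1 * 1 * h ^ (1 + 1)" using bc by (intro abs_mult_le) auto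
    then have "\<bar>b * c\<bar> \<le> M" using pow_le_M[of 2 1] by (simp add: numeral_2_eq_2)
    then have *: "at_most T {(a', d'). a' * d' = b * c}" using bc T by (intro product_solutions)
    have "at_most T {(a, d). (a - \<nu>) * (d - \<nu>) = b * c}"
      by (rule at_most_inj_on[OF *, where f = "\<lambda>(a, d). (a - \<nu>, d - \<nu>)"]) (auto simp: inj_on_def)
    then show "at_most T (case u of (b, c) \<Rightarrow> {(a, d). (a - \<nu>) * (d - \<nu>) = b * c})" by (simp add: uu)
  qed
  ultimately have "at_most (2 * m * (2 * m) + m * m * T)
     (?f ` (Sigma ?Z (\<lambda>_. {(a, d). a \<in> box \<and> d \<in> box \<and> (a - \<nu>) * (d - \<nu>) = 0}) \<union>
      Sigma (box \<times> box - ?Z) (\<lambda>(b, c). {(a, d). (a - \<nu>) * (d - \<nu>) = b * c})))"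
    by (intro at_most_image at_most_Un)
  moreover have "?S \<subseteq> ?f ` (Sigma ?Z (\<lambda>_. {(a, d). a \<in> box \<and> d \<in> box \<and> (a - \<nu>) * (d - \<nu>) = 0}) \<union>
      Sigma (box \<times> box - ?Z) (\<lambda>(b, c). {(a, d). (a - \<nu>) * (d - \<nu>) = b * c}))"
  proof
    fix B assume B: "B \<in> ?S"
    obtain a b c d where BB: "B = (a, b, c, d)" by (metis surj_pair)
    show "B \<in> ?f ` (Sigma ?Z (\<lambda>_. {(a, d). a \<in> box \<and> d \<in> box \<and> (a - \<nu>) * (d - \<nu>) = 0}) \<union>
      Sigma (box \<times> box - ?Z) (\<lambda>(b, c). {(a, d). (a - \<nu>) * (d - \<nu>) = b * c}))"
      using B by (intro image_eqI[where x = "((b, c), (a, d))"]) (auto simp: BB)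
  qed
  moreover have "2 * m * (2 * m) + m * m * T \<le> 5 * m\<^sup>2 * T"
    using mult_left_mono[OF T_ge_1, of "4 * m * m"] by (simp add: power2_eq_square)
  ultimately show ?thesis by (meson at_most_mono at_most_subset)
qed

text \<open>The last two equations say adj(B) u = \<nu> u. For nonscalar B they confine u to a line,
  and the prescribed value of v u confines v to a line: m choices each.\<close>

lemma eigenvector_solutions_fixed:
  "at_most (6 * m ^ 4 * T) {(B, u, v). (B, u, v) \<in> sols t s p \<and> u \<noteq> (0, 0) \<and>
     (case B of (a, b, c, d) \<Rightarrow> case u of (x, y) \<Rightarrow> (a - \<nu>) * (d - \<nu>) = b * c \<and>
       (\<nu> - d) * x + b * y = 0 \<and> c * x + (\<nu> - a) * y = 0)}" (is "at_most _ ?S")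
proof -
  \<comment> \<open>For B = \<nu> I the equations for u are void, but then B is a single matrix and
    u, v together have at most m^4 values.\<close>
  let ?I = "(\<nu>, 0, 0, \<nu>)"
  let ?E = "{(a, b, c, d). (a, b, c, d) \<in> boxes \<and> (a - \<nu>) * (d - \<nu>) = b * c}"
  let ?F = "\<lambda>(a, b, c, d). (SIGMA u:{(x, y). (x, y) \<in> box \<times> box \<and> (x, y) \<noteq> (0, 0) \<and>
       (\<nu> - d) * x + b * y = 0 \<and> c * x + (\<nu> - a) * y = 0}.
       {(z, w). z \<in> box \<and> w \<in> box \<and> fst u * z + snd u * w = (t - a - d) * (a + d) + (a * d - b * c) - s})"
  have 1: "at_most (5 * m ^ 2 * T * (m * m)) (Sigma (?E - {?I}) ?F)"
  proof (rule at_most_Sigma)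
    show "at_most (5 * m\<^sup>2 * T) (?E - {?I})" using matrices_with_eigenvalue by (rule at_most_subset) auto
    fix B assume B: "B \<in> ?E - {?I}"
    obtain a b c d where BB: "B = (a, b, c, d)" by (metis surj_pair)
    have "at_most (m * m) (?F (a, b, c, d))"
      unfolding prod.case
    proof (rule at_most_Sigma)
      have "b \<noteq> 0 \<or> c \<noteq> 0 \<or> \<nu> - d \<noteq> 0 \<or> \<nu> - a \<noteq> 0" using B by (auto simp: BB)
      then consider "\<nu> - d \<noteq> 0 \<or> b \<noteq> 0" | "c \<noteq> 0 \<or> \<nu> - a \<noteq> 0" by blast
      then show "at_most m {(x, y). (x, y) \<in> box \<times> box \<and> (x, y) \<noteq> (0, 0) \<and>
         (\<nu> - d) * x + b * y = 0 \<and> c * x + (\<nu> - a) * y = 0}"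
        by cases (auto intro: at_most_subset[OF line_solutions[of "\<nu> - d" b 0]]
            at_most_subset[OF line_solutions[of c "\<nu> - a" 0]])
      fix u :: "int \<times> int"
      assume u: "u \<in> {(x, y). (x, y) \<in> box \<times> box \<and> (x, y) \<noteq> (0, 0) \<and>
         (\<nu> - d) * x + b * y = 0 \<and> c * x + (\<nu> - a) * y = 0}"
      show "at_most m {(z, w). z \<in> box \<and> w \<in> box \<and>
          fst u * z + snd u * w = (t - a - d) * (a + d) + (a * d - b * c) - s}"
        using u by (intro line_solutions) auto
    qed
    then show "at_most (m * m) (?F B)" by (simp add: BB)
  qed
  have 2: "at_most (1 * (m * m * (m * m))) ({?I} \<times> ((box \<times> box) \<times> (box \<times> box)))"
    by (intro at_most_Sigma box2) (auto simp: at_most_def intro!: box2[unfolded at_most_def])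
  have "?S \<subseteq> Sigma (?E - {?I}) ?F \<union> {?I} \<times> ((box \<times> box) \<times> (box \<times> box))"
  proof
    fix q assume q: "q \<in> ?S"
    obtain a b c d x y z w where qq: "q = ((a, b, c, d), (x, y), (z, w))" by (metis surj_pair)
    show "q \<in> Sigma (?E - {?I}) ?F \<union> {?I} \<times> ((box \<times> box) \<times> (box \<times> box))"
      using q by (auto simp: qq sols_def mult.commute)
  qed
  then have "at_most (5 * m ^ 2 * T * (m * m) + 1 * (m * m * (m * m))) ?S"
    by (rule at_most_subset[OF at_most_Un[OF 1 2]])
  moreover have "5 * m ^ 2 * T * (m * m) + 1 * (m * m * (m * m)) \<le> 6 * m ^ 4 * T"
    using mult_left_mono[OF T_ge_1, of "m ^ 4"] by (simp add: eval_nat_numeral algebra_simps)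
  ultimately show ?thesis by (rule at_most_mono)
qed


text \<open>If B u = l u, the root of f is the other eigenvalue \<nu> = a + d - l. Indeed f(X) is (X
  - e) times the characteristic polynomial of B, minus v adj(X - B) u, and adj(X - B) u = (X -
  \<nu>) u; both terms vanish at \<nu>. The total is 6 for u = 0 plus 3 times 6.\<close>

lemma eigenvector_solutions:
  "at_most (24 * m ^ 4 * T) {(B, u, v). (B, u, v) \<in> sols t s p \<and> eigform B u = 0}" (is "at_most _ ?S")
proof -
  let ?R = "{\<nu>::int. \<nu> ^ 3 - t * \<nu>\<^sup>2 + s * \<nu> - p = 0}"
  let ?Z = "{(B, u, v). (B, u, v) \<in> sols t s p \<and> u = (0, 0)}"
  let ?F = "\<lambda>\<nu>. {(B, u, v). (B, u, v) \<in> sols t s p \<and> u \<noteq> (0, 0) \<and>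
     (case B of (a, b, c, d) \<Rightarrow> case u of (x, y) \<Rightarrow> (a - \<nu>) * (d - \<nu>) = b * c \<and>
       (\<nu> - d) * x + b * y = 0 \<and> c * x + (\<nu> - a) * y = 0)}"
  have "?S \<subseteq> ?Z \<union> (\<Union>\<nu>\<in>?R. ?F \<nu>)"
  proof
    fix q assume q: "q \<in> ?S"
    obtain a b c d x y z w where qq: "q = ((a, b, c, d), (x, y), (z, w))" by (metis surj_pair)
    have sol: "((a, b, c, d), (x, y), (z, w)) \<in> sols t s p"
      and mu: "c * x\<^sup>2 + (d - a) * x * y - b * y\<^sup>2 = 0" using q by (auto simp: qq eigform_def)
    note S = solsD[OF sol]
    show "q \<in> ?Z \<union> (\<Union>\<nu>\<in>?R. ?F \<nu>)"
    proof (cases "(x, y) = (0, 0)")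
      case True
      then show ?thesis using sol by (simp add: qq)
    next
      case False
      obtain l where l: "a * x + b * y = l * x" "c * x + d * y = l * y"
        using integral_eigenvalue[OF False mu] by blast
      define \<nu> where "\<nu> = a + d - l"
      have "((a - l) * (d - l) - b * c) * x = (d - l) * (a * x + b * y - l * x) - b * (c * x + d * y - l * y)"
        "((a - l) * (d - l) - b * c) * y = (a - l) * (c * x + d * y - l * y) - c * (a * x + b * y - l * x)"
        by (simp_all add: algebra_simps)
      then have "(a - l) * (d - l) = b * c" using l False by auto
      then have ch: "(a - \<nu>) * (d - \<nu>) = b * c" by (simp add: \<nu>_def algebra_simps)
      have ev: "(\<nu> - d) * x + b * y = 0" "c * x + (\<nu> - a) * y = 0" using l by (simp_all add: \<nu>_def algebra_simps)
      then have adj: "d * x - b * y = \<nu> * x" "a * y - c * x = \<nu> * y" by (simp_all add: algebra_simps)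
      define e where "e = t - a - d"
      have s: "s = e * (a + d) + (a * d - b * c) - (z * x + w * y)" using S(9) by (simp add: e_def)
      have p: "p = e * (a * d - b * c) - \<nu> * (z * x + w * y)"
        using S(10) unfolding adj by (simp add: e_def algebra_simps)
      have t: "t = e + a + d" by (simp add: e_def)
      have "\<nu> ^ 3 - t * \<nu>\<^sup>2 + s * \<nu> - p = (\<nu> - e) * ((a - \<nu>) * (d - \<nu>) - b * c)"
        unfolding s p t by (simp add: algebra_simps power2_eq_square power3_eq_cube)
      then have "\<nu> \<in> ?R" using ch by simp
      moreover have "q \<in> ?F \<nu>" using sol False ch ev by (simp add: qq)
      ultimately show ?thesis by blast
    qed
  qed
  moreover have "at_most (6 * m ^ 4 * T + 3 * (6 * m ^ 4 * T)) (?Z \<union> (\<Union>\<nu>\<in>?R. ?F \<nu>))"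
    by (intro at_most_Un zero_vector_solutions at_most_UN integer_roots_cubic eigenvector_solutions_fixed)
  ultimately have "at_most (6 * m ^ 4 * T + 3 * (6 * m ^ 4 * T)) ?S" by (rule at_most_subset[rotated])
  then show ?thesis by (rule at_most_mono) simp
qed

text \<open>Transposing the whole matrix transposes B, exchanges u with v and preserves f.\<close>

lemma left_eigenvector_solutions:
  "at_most (24 * m ^ 4 * T) {(B, u, v). (B, u, v) \<in> sols t s p \<and> eigform (block_transpose B) v = 0}" (is "at_most _ ?S")
proof (rule at_most_inj_on[OF eigenvector_solutions, where f = "\<lambda>(B, u, v). (block_transpose B, v, u)"])
  show "inj_on (\<lambda>(B, u, v). (block_transpose B, v, u)) ?S" by (auto simp: inj_on_def block_transpose_def)
  show "(\<lambda>(B, u, v). (block_transpose B, v, u)) ` ?S \<subseteq> {(B, u, v). (B, u, v) \<in> sols t s p \<and> eigform B u = 0}"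
    by (auto simp: sols_def block_transpose_def algebra_simps)
qed

text \<open>The two equations are linear in v, with coefficient vectors u and adj(B) u. Their
  determinant is -det(u, B u), and the displayed identities are Cramer's rule.\<close>

lemma nonsingular_solution_unique:
  assumes "((a, b, c, d), (x, y), v) \<in> sols t s p" "((a, b, c, d), (x, y), v') \<in> sols t s p"
    and "c * x\<^sup>2 + (d - a) * x * y - b * y\<^sup>2 \<noteq> 0"
  shows "v = v'"
proof -
  obtain z w z' w' where v: "v = (z, w)" "v' = (z', w')" by (metis surj_pair)
  note S = solsD[OF assms(1)[unfolded v]] and S' = solsD[OF assms(2)[unfolded v]]
  have "(z - z') * x + (w - w') * y = 0" "(z - z') * (d * x - b * y) + (w - w') * (a * y - c * x) = 0"
    using S(9,10) S'(9,10) by (simp_all add: algebra_simps)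
  moreover have "(z - z') * (c * x\<^sup>2 + (d - a) * x * y - b * y\<^sup>2) =
      y * ((z - z') * (d * x - b * y) + (w - w') * (a * y - c * x)) - (a * y - c * x) * ((z - z') * x + (w - w') * y)"
    by (simp add: algebra_simps power2_eq_square)
  moreover have "(w - w') * (c * x\<^sup>2 + (d - a) * x * y - b * y\<^sup>2) =
      (d * x - b * y) * ((z - z') * x + (w - w') * y) - x * ((z - z') * (d * x - b * y) + (w - w') * (a * y - c * x))"
    by (simp add: algebra_simps power2_eq_square)
  ultimately have "(z - z') * (c * x\<^sup>2 + (d - a) * x * y - b * y\<^sup>2) = 0"
    "(w - w') * (c * x\<^sup>2 + (d - a) * x * y - b * y\<^sup>2) = 0" by simp_all
  then show ?thesis using assms(3) by (simp add: v)
qed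

text \<open>For a = d the condition is b c = 0. For a \<noteq> d the pair (4 b, c) is a
  factorization of the nonzero number -(d - a)^2.\<close>

lemma matrices_with_zero_discriminant:
  "at_most (3 * m ^ 2 * T) {(a, b, c, d). (a, b, c, d) \<in> boxes \<and> (d - a)\<^sup>2 + 4 * b * c = 0}" (is "at_most _ ?S")
proof -
  let ?f = "\<lambda>((a, d), (b, c)). (a, b, c, d)"
  let ?U1 = "SIGMA a:box. {(b, c). b \<in> box \<and> c \<in> box \<and> b * c = (0::int)}"
  let ?f1 = "\<lambda>(a, (b, c)). (a, b, c, a)"
  let ?U2 = "SIGMA u:{(a, d). a \<in> box \<and> d \<in> box \<and> a \<noteq> d}. {(b, c). 4 * (b * c) = - ((snd u - fst u)\<^sup>2)}"
  have 1: "at_most (m * (2 * m)) (?f1 ` ?U1)"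
    by (intro at_most_image at_most_Sigma box zero_product_solutions)
  have 2: "at_most (m * m * T) (?f ` ?U2)"
  proof (intro at_most_image at_most_Sigma)
    show "at_most (m * m) {(a, d). a \<in> box \<and> d \<in> box \<and> a \<noteq> d}" using box2 by (rule at_most_subset) auto
    fix u assume u: "u \<in> {(a, d). a \<in> box \<and> d \<in> box \<and> a \<noteq> d}"
    obtain a d where uu: "u = (a, d)" by (metis surj_pair)
    have ad: "\<bar>a\<bar> \<le> h" "\<bar>d\<bar> \<le> h" "a \<noteq> d" using u by (auto simp: uu)
    have "\<bar>(d - a) * (d - a)\<bar> \<le> 2 * 2 * h ^ (1 + 1)" using ad by (intro abs_mult_le) auto
    then have dM: "\<bar>- ((d - a)\<^sup>2)\<bar> \<le> M" using pow_le_M[of 2 4] by (simp add: power2_eq_square numeral_2_eq_2)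
    have *: "at_most T {(b, c). b * c = - ((d - a)\<^sup>2)}" using ad dM T by (intro product_solutions) auto
    have "at_most T {(b, c). 4 * (b * c) = - ((d - a)\<^sup>2)}"
      by (rule at_most_inj_on[OF *, where f = "\<lambda>(b, c). (4 * b, c)"]) (auto simp: inj_on_def)
    then show "at_most T {(b, c). 4 * (b * c) = - ((snd u - fst u)\<^sup>2)}" by (simp add: uu)
  qed
  have "?S \<subseteq> ?f1 ` ?U1 \<union> ?f ` ?U2"
  proof
    fix B assume B: "B \<in> ?S"
    obtain a b c d where BB: "B = (a, b, c, d)" by (metis surj_pair)
    show "B \<in> ?f1 ` ?U1 \<union> ?f ` ?U2"
    proof (cases "a = d")
      case True
      then have "B \<in> ?f1 ` ?U1" using B by (intro image_eqI[where x = "(a, (b, c))"]) (auto simp: BB)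
      then show ?thesis by blast
    next
      case False
      then have "B \<in> ?f ` ?U2" using B by (intro image_eqI[where x = "((a, d), (b, c))"]) (auto simp: BB)
      then show ?thesis by blast
    qed
  qed
  then have "at_most (m * (2 * m) + m * m * T) ?S" by (rule at_most_subset[OF at_most_Un[OF 1 2]])
  moreover have "m * (2 * m) + m * m * T \<le> 3 * m\<^sup>2 * T"
    using mult_left_mono[OF T_ge_1, of "2 * m * m"] by (simp add: power2_eq_square)
  ultimately show ?thesis by (rule at_most_mono)
qed

lemma zero_discriminant_solutions:
  "at_most (3 * m ^ 4 * T) {(B, u, v). (B, u, v) \<in> sols t s p \<and> eigform B u \<noteq> 0 \<and>
    (case B of (a, b, c, d) \<Rightarrow> (d - a)\<^sup>2 + 4 * b * c = 0)}" (is "at_most _ ?S")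
proof -
  let ?E = "{(a, b, c, d). (a, b, c, d) \<in> boxes \<and> (d - a)\<^sup>2 + 4 * b * c = 0}"
  have *: "at_most (3 * m ^ 2 * T * (m * m)) (?E \<times> (box \<times> box))"
    by (intro at_most_Sigma matrices_with_zero_discriminant box2)
  have "at_most (3 * m ^ 2 * T * (m * m)) ?S"
  proof (rule at_most_inj_on[OF *, where f = "\<lambda>(B, u, v). (B, u)"])
    show "inj_on (\<lambda>(B, u, v). (B, u)) ?S"
    proof (rule inj_onI)
      fix q q' assume q: "q \<in> ?S" "q' \<in> ?S" "(\<lambda>(B, u, v). (B, u)) q = (\<lambda>(B, u, v). (B, u)) q'"
      then obtain a b c d x y v v' where qq: "q = ((a, b, c, d), (x, y), v)" "q' = ((a, b, c, d), (x, y), v')"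
        by (cases q; cases q') auto
      have "v = v'"
        by (rule nonsingular_solution_unique[of a b c d x y]) (use q in \<open>auto simp: qq eigform_def\<close>)
      then show "q = q'" by (simp add: qq)
    qed
    show "(\<lambda>(B, u, v). (B, u)) ` ?S \<subseteq> ?E \<times> (box \<times> box)" by (auto simp: sols_def)
  qed
  then show ?thesis by (simp add: eval_nat_numeral algebra_simps)
qed

text \<open>For a fixed block \<open>B\<close>, both \<open>v u\<close> and \<open>v adj(B) u\<close> are determined, and the product of the two
  binary quadratic forms \<open>det(u, B u)\<close> and \<open>det(v, v B)\<close> is a polynomial in these two numbers and
  the entries of \<open>B\<close>. Hence the value at \<open>u\<close> of the first form divides a fixed integer.\<close>

lemma form_product:
  fixes a b c d x y z w :: int
  shows "(c * x\<^sup>2 + (d - a) * x * y - b * y\<^sup>2) * (b * z\<^sup>2 + (d - a) * z * w - c * w\<^sup>2) =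
    (a + d) * (z * x + w * y) * (z * (d * x - b * y) + w * (a * y - c * x))
    - (a * d - b * c) * (z * x + w * y)\<^sup>2 - (z * (d * x - b * y) + w * (a * y - c * x))\<^sup>2"
  by (simp add: algebra_simps power2_eq_square)

text \<open>After the choice of B, a divisor k of N costs T, a vector u on which the form takes the
  value k costs 25 T^3, and v is then unique.\<close>

lemma generic_solutions:
  "at_most (25 * m ^ 4 * T ^ 4) {(B, u, v). (B, u, v) \<in> sols t s p \<and> eigform B u \<noteq> 0 \<and> eigform (block_transpose B) v \<noteq> 0 \<and>
    (case B of (a, b, c, d) \<Rightarrow> (d - a)\<^sup>2 + 4 * b * c \<noteq> 0)}" (is "at_most _ ?S")
proof -
  have "at_most (m * (m * (m * m)) * (T * (25 * T ^ 3))) ?S"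
  proof (rule at_most_fibers[OF boxes, where f = fst])
    show "fst ` ?S \<subseteq> boxes" by (auto simp: sols_def)
    fix B assume "B \<in> boxes"
    obtain a b c d where BB: "B = (a, b, c, d)" by (metis surj_pair)
    let ?C = "{q \<in> ?S. fst q = B}"
    show "at_most (T * (25 * T ^ 3)) ?C"
    proof (rule at_most_if_nonempty)
      assume "?C \<noteq> {}"
      \<comment> \<open>\<alpha> and g are the prescribed values of v u and v adj(B) u; N is the
        product of the two forms expressed through them.\<close>
      define \<alpha> where "\<alpha> = (t - a - d) * (a + d) + (a * d - b * c) - s"
      define g where "g = (t - a - d) * (a * d - b * c) - p"
      define N where "N = (a + d) * \<alpha> * g - (a * d - b * c) * \<alpha>\<^sup>2 - g\<^sup>2"
      have N: "c * x\<^sup>2 + (d - a) * x * y - b * y\<^sup>2 dvd N \<and> N \<noteq> 0 \<and> \<bar>N\<bar> \<le> M \<and> x \<in> box \<and> y \<in> box"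
        if "((a, b, c, d), (x, y), (z, w)) \<in> ?C" for x y z w
      proof -
        have sol: "((a, b, c, d), (x, y), (z, w)) \<in> sols t s p"
          and mu: "c * x\<^sup>2 + (d - a) * x * y - b * y\<^sup>2 \<noteq> 0" "b * z\<^sup>2 + (d - a) * z * w - c * w\<^sup>2 \<noteq> 0"
          using that by (auto simp: eigform_def block_transpose_def)
        note S = solsD[OF sol]
        have Ne: "N = (c * x\<^sup>2 + (d - a) * x * y - b * y\<^sup>2) * (b * z\<^sup>2 + (d - a) * z * w - c * w\<^sup>2)"
          unfolding N_def \<alpha>_def g_def form_product S(9,10) by simp
        have form_le: "\<bar>c * x\<^sup>2 + (d - a) * x * y - b * y\<^sup>2\<bar> \<le> 4 * h ^ 3"
          if "\<bar>b\<bar> \<le> h" "\<bar>c\<bar> \<le> h" "\<bar>x\<bar> \<le> h" "\<bar>y\<bar> \<le> h" for b c x y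
        proof -
          have da: "\<bar>d - a\<bar> \<le> 2 * h ^ 1" using S(1,4) by simp
          have b1: "\<bar>c * (x * x)\<bar> \<le> (1 * (1 * 1)) * h ^ (1 + (1 + 1))"
            "\<bar>(d - a) * (x * y)\<bar> \<le> (2 * (1 * 1)) * h ^ (1 + (1 + 1))"
            "\<bar>b * (y * y)\<bar> \<le> (1 * (1 * 1)) * h ^ (1 + (1 + 1))"
            using that da by (intro abs_mult_le; simp)+
          have "c * x\<^sup>2 + (d - a) * x * y - b * y\<^sup>2 = c * (x * x) + (d - a) * (x * y) - b * (y * y)"
            by (simp add: power2_eq_square)
          then show ?thesis using b1 by (simp add: eval_nat_numeral)
        qed
        have "\<bar>N\<bar> \<le> (4 * 4) * h ^ (3 + 3)" unfolding Ne using S by (intro abs_mult_le form_le) auto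
        then have "\<bar>N\<bar> \<le> M" using pow_le_M[of 6 16] by simp
        then show ?thesis using mu S unfolding Ne by (auto simp: abs_le_iff)
      qed
      \<comment> \<open>N involves the unbounded t, s and p. One solution shows that it is nonzero
        and at most 16 h^6, being a product of two form values.\<close>
      obtain q where "q \<in> ?C" using \<open>?C \<noteq> {}\<close> by blast
      moreover obtain a' b' c' d' x0 y0 z0 w0 where "q = ((a', b', c', d'), (x0, y0), (z0, w0))" by (metis surj_pair)
      ultimately have q: "((a, b, c, d), (x0, y0), (z0, w0)) \<in> ?C" by (auto simp: BB)
      then have N0: "N \<noteq> 0" "\<bar>N\<bar> \<le> M" using N by blast+
      have D0: "(d - a)\<^sup>2 + 4 * b * c \<noteq> 0" and abcd: "\<bar>a\<bar> \<le> h" "\<bar>b\<bar> \<le> h" "\<bar>c\<bar> \<le> h" "\<bar>d\<bar> \<le> h"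
        using q by (auto simp: sols_def abs_le_iff)
      let ?W = "\<Union>k\<in>{k. k dvd N}. {(x, y). x \<in> box \<and> y \<in> box \<and> c * x\<^sup>2 + (d - a) * x * y - b * y\<^sup>2 = k}"
      have *: "at_most (T * (25 * T ^ 3)) ?W"
      proof (rule at_most_UN)
        show "at_most T {k. k dvd N}" using T N0 by (auto simp: at_most_def intro: divisor_boundD)
        fix k assume "k \<in> {k. k dvd N}"
        then have "k \<noteq> 0" using N0 by auto
        then show "at_most (25 * T ^ 3) {(x, y). x \<in> box \<and> y \<in> box \<and> c * x\<^sup>2 + (d - a) * x * y - b * y\<^sup>2 = k}"
          by (intro form_solutions abcd D0)
      qed
      show "at_most (T * (25 * T ^ 3)) ?C"
      proof (rule at_most_inj_on[OF *, where f = "\<lambda>(B, u, v). u"])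
        show "inj_on (\<lambda>(B, u, v). u) ?C"
        proof (rule inj_onI)
          fix q q' assume q: "q \<in> ?C" "q' \<in> ?C" "(\<lambda>(B, u, v). u) q = (\<lambda>(B, u, v). u) q'"
          then obtain x y v v' where qq: "q = ((a, b, c, d), (x, y), v)" "q' = ((a, b, c, d), (x, y), v')"
            unfolding BB by (cases q; cases q') auto
          have "v = v'"
            by (rule nonsingular_solution_unique[of a b c d x y]) (use q in \<open>auto simp: qq eigform_def\<close>)
          then show "q = q'" by (simp add: qq)
        qed
        show "(\<lambda>(B, u, v). u) ` ?C \<subseteq> ?W"
        proof (rule image_subsetI)
          fix q assume q: "q \<in> ?C"
          obtain a' b' c' d' x y z w where "q = ((a', b', c', d'), (x, y), (z, w))" by (metis surj_pair)
          then have qq: "q = ((a, b, c, d), (x, y), (z, w))" using q by (auto simp: BB)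
          have "c * x\<^sup>2 + (d - a) * x * y - b * y\<^sup>2 dvd N \<and> x \<in> box \<and> y \<in> box"
            using N[of x y z w] q unfolding qq by blast
          then show "(\<lambda>(B, u, v). u) q \<in> ?W" by (simp add: qq)
        qed
      qed
    qed
  qed
  then show ?thesis by (simp add: eval_nat_numeral algebra_simps)
qed

text \<open>76 = 24 + 24 + 3 + 25: eigenvector on the right, on the left, zero discriminant, generic
  case.\<close>

lemma card_sols: "at_most (76 * m ^ 4 * T ^ 4) (sols t s p)"
proof -
  let ?A = "{(B, u, v). (B, u, v) \<in> sols t s p \<and> eigform B u = 0}"
  let ?B = "{(B, u, v). (B, u, v) \<in> sols t s p \<and> eigform (block_transpose B) v = 0}"
  let ?C = "{(B, u, v). (B, u, v) \<in> sols t s p \<and> eigform B u \<noteq> 0 \<and>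
    (case B of (a, b, c, d) \<Rightarrow> (d - a)\<^sup>2 + 4 * b * c = 0)}"
  let ?D = "{(B, u, v). (B, u, v) \<in> sols t s p \<and> eigform B u \<noteq> 0 \<and> eigform (block_transpose B) v \<noteq> 0 \<and>
    (case B of (a, b, c, d) \<Rightarrow> (d - a)\<^sup>2 + 4 * b * c \<noteq> 0)}"
  have "at_most ((24 * m ^ 4 * T + 24 * m ^ 4 * T) + (3 * m ^ 4 * T + 25 * m ^ 4 * T ^ 4)) ((?A \<union> ?B) \<union> (?C \<union> ?D))"
    by (intro at_most_Un eigenvector_solutions left_eigenvector_solutions zero_discriminant_solutions generic_solutions)
  moreover have "sols t s p \<subseteq> (?A \<union> ?B) \<union> (?C \<union> ?D)" by auto
  ultimately have "at_most ((24 * m ^ 4 * T + 24 * m ^ 4 * T) + (3 * m ^ 4 * T + 25 * m ^ 4 * T ^ 4)) (sols t s p)"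
    by (rule at_most_subset)
  moreover have "m ^ 4 * T \<le> m ^ 4 * T ^ 4"
    using T_ge_1 power_increasing[of 1 4 T] by (intro mult_left_mono) auto
  ultimately show ?thesis by (elim at_most_mono) linarith
qed

end

subsection \<open>Characteristic polynomials and the exponent\<close>

lemma det_2:
  fixes A :: "'a :: comm_ring_1 mat"
  assumes "A \<in> carrier_mat 2 2"
  shows "det A = A $$ (0,0) * A $$ (1,1) - A $$ (0,1) * A $$ (1,0)"
proof -
  have "det (mat_delete A 0 j) = mat_delete A 0 j $$ (0,0)" if "j < 2" for j
    using assms mat_delete_carrier[of A 2 2] by (intro det_single) simp
  moreover have "det A = (\<Sum>j<2. A $$ (0,j) * cofactor A 0 j)"
    using assms by (intro laplace_expansion_row) auto
  ultimately show ?thesis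
    using assms by (simp add: numeral_2_eq_2 cofactor_def mat_delete_def)
qed

lemma det_3:
  fixes A :: "'a :: comm_ring_1 mat"
  assumes "A \<in> carrier_mat 3 3"
  shows "det A = A $$ (0,0) * (A $$ (1,1) * A $$ (2,2) - A $$ (1,2) * A $$ (2,1))
    - A $$ (0,1) * (A $$ (1,0) * A $$ (2,2) - A $$ (1,2) * A $$ (2,0))
    + A $$ (0,2) * (A $$ (1,0) * A $$ (2,1) - A $$ (1,1) * A $$ (2,0))"
proof -
  define B where "B j = mat_delete A 0 j" for j
  have "det (B j) = B j $$ (0,0) * B j $$ (1,1) - B j $$ (0,1) * B j $$ (1,0)" for j
    unfolding B_def using assms mat_delete_carrier[of A 3 3] by (intro det_2) simp
  moreover have "det A = (\<Sum>j<3. A $$ (0,j) * cofactor A 0 j)"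
    using assms by (intro laplace_expansion_row) auto
  moreover have "B j $$ (i, k) = A $$ (Suc i, if k < j then k else Suc k)" if "i < 2" "k < 2" for i j k
    using assms that by (simp add: B_def mat_delete_def)
  ultimately show ?thesis
    by (simp add: eval_nat_numeral cofactor_def B_def[symmetric]) (simp add: right_diff_distrib)
qed

lemma char_poly_2:
  fixes A :: "int mat"
  assumes "A \<in> carrier_mat 2 2"
  shows "char_poly A = [:A $$ (0,0) * A $$ (1,1) - A $$ (0,1) * A $$ (1,0), - (A $$ (0,0) + A $$ (1,1)), 1:]"
proof -
  have "char_poly_matrix A \<in> carrier_mat 2 2" using assms by simp
  then show ?thesis unfolding char_poly_def using assms
    by (subst det_2) (auto simp: char_poly_matrix_def algebra_simps)
qed

text \<open>The coefficients are grouped by the bordered shape, so that v adj(B) u and v u appear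
  just as in \<open>sols\<close>.\<close>

lemma char_poly_3:
  fixes A :: "int mat"
  assumes "A \<in> carrier_mat 3 3"
  defines "e \<equiv> A $$ (2,2)" and "\<tau> \<equiv> A $$ (0,0) + A $$ (1,1)"
    and "\<delta> \<equiv> A $$ (0,0) * A $$ (1,1) - A $$ (0,1) * A $$ (1,0)"
  shows "char_poly A =
    [:A $$ (2,0) * (A $$ (1,1) * A $$ (0,2) - A $$ (0,1) * A $$ (1,2))
      + A $$ (2,1) * (A $$ (0,0) * A $$ (1,2) - A $$ (1,0) * A $$ (0,2)) - e * \<delta>,
      e * \<tau> + \<delta> - (A $$ (2,0) * A $$ (0,2) + A $$ (2,1) * A $$ (1,2)), - (e + \<tau>), 1:]"
proof -
  have "char_poly_matrix A \<in> carrier_mat 3 3" using assms by simp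
  then show ?thesis unfolding char_poly_def using assms
    by (subst det_3) (auto simp: char_poly_matrix_def algebra_simps)
qed

section \<open>Two by two matrices\<close>

context height
begin

text \<open>Here d = t - a. If b c = 0, then a is a root of X^2 - t X + \<delta>, so it has at most
  2 values, with 2 m pairs (b, c) each. Otherwise each a leaves at most T pairs.\<close>

lemma card_sols_2: "at_most (5 * m * T) {(a, b, c). a \<in> box \<and> b \<in> box \<and> c \<in> box \<and> b * c = a * (t - a) - \<delta>}"
  (is "at_most _ ?S")
proof -
  let ?U1 = "SIGMA a:{a. (2 * a - t)\<^sup>2 = t\<^sup>2 - 4 * \<delta>}. {(b, c). b \<in> box \<and> c \<in> box \<and> b * c = 0}"
  let ?U2 = "SIGMA a:{a. a \<in> box \<and> a * (t - a) \<noteq> \<delta>}. {(b, c). b \<in> box \<and> c \<in> box \<and> b * c = a * (t - a) - \<delta>}"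
  have sq: "at_most 2 {y::int. y\<^sup>2 = t\<^sup>2 - 4 * \<delta>}"
    by (simp add: at_most_def card_square_eq finite_square_eq)
  have 1: "at_most (2 * (2 * m)) ?U1"
  proof (rule at_most_Sigma[OF _ zero_product_solutions])
    show "at_most 2 {a. (2 * a - t)\<^sup>2 = t\<^sup>2 - 4 * \<delta>}"
      by (rule at_most_inj_on[OF sq, where f = "\<lambda>a. 2 * a - t"]) (auto simp: inj_on_def)
  qed
  have 2: "at_most (m * T) ?U2"
  proof (rule at_most_Sigma)
    show "at_most m {a. a \<in> box \<and> a * (t - a) \<noteq> \<delta>}" using box by (rule at_most_subset) auto
    fix a assume a: "a \<in> {a. a \<in> box \<and> a * (t - a) \<noteq> \<delta>}"
    let ?P = "{(b, c). b \<in> box \<and> c \<in> box \<and> b * c = a * (t - a) - \<delta>}"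
    show "at_most T ?P"
    proof (rule at_most_if_nonempty)
      assume "?P \<noteq> {}"
      then obtain b c where "b \<in> box" "c \<in> box" and bc: "b * c = a * (t - a) - \<delta>" by blast
      then have "\<bar>b * c\<bar> \<le> 1 * 1 * h ^ (1 + 1)" by (intro abs_mult_le) auto
      then have "\<bar>a * (t - a) - \<delta>\<bar> \<le> M" using pow_le_M[of 2 1] bc by (simp add: numeral_2_eq_2)
      then have "at_most T {(b, c). b * c = a * (t - a) - \<delta>}" using a T by (intro product_solutions) auto
      then show "at_most T ?P" by (rule at_most_subset) auto
    qed
  qed
  have "?S \<subseteq> ?U1 \<union> ?U2"
  proof
    fix q assume q: "q \<in> ?S"
    obtain a b c where qq: "q = (a, b, c)" by (metis surj_pair)
    show "q \<in> ?U1 \<union> ?U2"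
    proof (cases "a * (t - a) = \<delta>")
      case True
      then have "(2 * a - t)\<^sup>2 = t\<^sup>2 - 4 * \<delta>" by (simp add: algebra_simps power2_eq_square)
      then show ?thesis using q True by (auto simp: qq)
    next
      case False
      then show ?thesis using q by (auto simp: qq)
    qed
  qed
  then have "at_most (2 * (2 * m) + m * T) ?S" by (rule at_most_subset[OF at_most_Un[OF 1 2]])
  moreover have "2 * (2 * m) + m * T \<le> 5 * m * T"
    using mult_left_mono[OF T_ge_1, of "4 * m"] by simp
  ultimately show ?thesis by (rule at_most_mono)
qed

end

section \<open>From solution counts to exponents\<close>

lemma card_le_if_at_most: "at_most n S \<Longrightarrow> card S \<le> n"
  by (simp add: at_most_def)

lemma int_mats_entry: "A \<in> int_mats n H \<Longrightarrow> i < n \<Longrightarrow> j < n \<Longrightarrow> A $$ (i, j) \<in> {- \<lfloor>H\<rfloor>..\<lfloor>H\<rfloor>}"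
proof -
  assume "A \<in> int_mats n H" "i < n" "j < n"
  then have "real_of_int \<bar>A $$ (i, j)\<bar> \<le> H" by (auto simp: int_mats_def)
  then have "\<bar>A $$ (i, j)\<bar> \<le> \<lfloor>H\<rfloor>" by (simp add: le_floor_iff)
  then show ?thesis by auto
qed

text \<open>The constant is 5 times 3, from m \<le> 3 H. The factor T is weakened to T^4 so that
  both dimensions fit one passage to exponents.\<close>

lemma R_count_2_le:
  assumes H: "H \<ge> 1" and T: "divisor_bound T (256 * \<lfloor>H\<rfloor> ^ 6)"
  shows "real (R_count 2 H f) \<le> 15 * H ^ 1 * real T ^ 4"
proof -
  interpret height "\<lfloor>H\<rfloor>" "256 * \<lfloor>H\<rfloor> ^ 6" T
    using assms by unfold_locales auto
  define t \<delta> where "t = - coeff f 1" and "\<delta> = coeff f 0"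
  have "at_most (5 * m * T) {A \<in> int_mats 2 H. char_poly A = f}" (is "at_most _ ?S")
  proof (rule at_most_inj_on[OF card_sols_2, where f = "\<lambda>A. (A $$ (0,0), A $$ (0,1), A $$ (1,0))"])
    have co: "A $$ (0,0) + A $$ (1,1) = t \<and> A $$ (0,0) * A $$ (1,1) - A $$ (0,1) * A $$ (1,0) = \<delta>"
      if "A \<in> ?S" for A
    proof -
      have "f = [:A $$ (0,0) * A $$ (1,1) - A $$ (0,1) * A $$ (1,0), - (A $$ (0,0) + A $$ (1,1)), 1:]"
        using that char_poly_2[of A] by (auto simp: int_mats_def)
      then show ?thesis by (simp add: t_def \<delta>_def)
    qed
    show "(\<lambda>A. (A $$ (0,0), A $$ (0,1), A $$ (1,0))) ` ?S \<subseteq>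
      {(a, b, c). a \<in> box \<and> b \<in> box \<and> c \<in> box \<and> b * c = a * (t - a) - \<delta>}"
    proof (rule image_subsetI)
      fix A assume A: "A \<in> ?S"
      then have "A $$ (i, j) \<in> box" if "i < 2" "j < 2" for i j using that int_mats_entry by blast
      moreover have "A $$ (1,1) = t - A $$ (0,0)" using co[OF A] by simp
      then have "A $$ (0,1) * A $$ (1,0) = A $$ (0,0) * (t - A $$ (0,0)) - \<delta>" using co[OF A] by simp
      ultimately show "(A $$ (0,0), A $$ (0,1), A $$ (1,0)) \<in>
        {(a, b, c). a \<in> box \<and> b \<in> box \<and> c \<in> box \<and> b * c = a * (t - a) - \<delta>}" by simp
    qed
    show "inj_on (\<lambda>A. (A $$ (0,0), A $$ (0,1), A $$ (1,0))) ?S"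
    proof (rule inj_onI)
      fix A B assume A: "A \<in> ?S" and B: "B \<in> ?S"
        and eq: "(A $$ (0,0), A $$ (0,1), A $$ (1,0)) = (B $$ (0,0), B $$ (0,1), B $$ (1,0))"
      show "A = B"
      proof (rule eq_matI)
        fix i j assume "i < dim_row B" "j < dim_col B"
        then have "i < 2" "j < 2" using B by (auto simp: int_mats_def)
        then show "A $$ (i, j) = B $$ (i, j)" using eq co[OF A] co[OF B] by (auto simp: less_2_cases_iff)
      qed (use A B in \<open>auto simp: int_mats_def\<close>)
    qed
  qed
  then have "R_count 2 H f \<le> 5 * m * T" unfolding R_count_def by (rule card_le_if_at_most)
  then have "real (R_count 2 H f) \<le> real (5 * m * T)" by (rule of_nat_mono)
  also have "\<dots> = 5 * real m * real T" by simp
  also have "\<dots> \<le> 5 * (3 * H) * real T ^ 4"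
  proof (intro mult_mono)
    have "real m = 2 * of_int \<lfloor>H\<rfloor> + 1" unfolding m_def using H by simp
    then show "real m \<le> 3 * H" using H of_int_floor_le[of H] by linarith
    show "real T \<le> real T ^ 4" using T_ge_1 power_increasing[of 1 4 "real T"] by simp
  qed (use H in auto)
  finally show ?thesis by simp
qed

lemma R_count_3_le:
  assumes H: "H \<ge> 1" and T: "divisor_bound T (256 * \<lfloor>H\<rfloor> ^ 6)"
  shows "real (R_count 3 H f) \<le> 6156 * H ^ 4 * real T ^ 4"
proof -
  interpret height "\<lfloor>H\<rfloor>" "256 * \<lfloor>H\<rfloor> ^ 6" T
    using assms by unfold_locales auto
  \<comment> \<open>The signs make f = X^3 - t X^2 + s X - p for every f that is the characteristic
    polynomial of some 3 x 3 matrix.\<close>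
  define t s p where "t = - coeff f 2" and "s = coeff f 1" and "p = - coeff f 0"
  let ?f = "\<lambda>A. ((A $$ (0,0), A $$ (0,1), A $$ (1,0), A $$ (1,1)), (A $$ (0,2), A $$ (1,2)), (A $$ (2,0), A $$ (2,1)))"
  have "at_most (76 * m ^ 4 * T ^ 4) {A \<in> int_mats 3 H. char_poly A = f}" (is "at_most _ ?S")
  proof (rule at_most_inj_on[OF card_sols, where f = ?f])
    have co: "A $$ (2,2) = t - A $$ (0,0) - A $$ (1,1) \<and> ?f A \<in> sols t s p" if A: "A \<in> ?S" for A
    proof -
      have b: "A $$ (i, j) \<in> box" if "i < 3" "j < 3" for i j using that A int_mats_entry by blast
      have "A \<in> carrier_mat 3 3" and "f = char_poly A" using A by (auto simp: int_mats_def)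
      note f = \<open>f = char_poly A\<close>[unfolded char_poly_3[OF \<open>A \<in> carrier_mat 3 3\<close>]]
      have e: "A $$ (2,2) = t - A $$ (0,0) - A $$ (1,1)" unfolding t_def f by (simp add: numeral_2_eq_2)
      have "A $$ (2,0) * A $$ (0,2) + A $$ (2,1) * A $$ (1,2) =
          A $$ (2,2) * (A $$ (0,0) + A $$ (1,1)) + (A $$ (0,0) * A $$ (1,1) - A $$ (0,1) * A $$ (1,0)) - s"
        unfolding s_def f by simp
      moreover have "A $$ (2,0) * (A $$ (1,1) * A $$ (0,2) - A $$ (0,1) * A $$ (1,2))
          + A $$ (2,1) * (A $$ (0,0) * A $$ (1,2) - A $$ (1,0) * A $$ (0,2)) =
          A $$ (2,2) * (A $$ (0,0) * A $$ (1,1) - A $$ (0,1) * A $$ (1,0)) - p"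
        unfolding p_def f by simp
      ultimately show ?thesis unfolding e sols_def using b e by simp
    qed
    then show "?f ` ?S \<subseteq> sols t s p" by blast
    show "inj_on ?f ?S"
    proof (rule inj_onI)
      fix A B assume A: "A \<in> ?S" and B: "B \<in> ?S" and eq: "?f A = ?f B"
      show "A = B"
      proof (rule eq_matI)
        fix i j assume "i < dim_row B" "j < dim_col B"
        then have "i < 3" "j < 3" using B by (auto simp: int_mats_def)
        then have "i = 0 \<or> i = 1 \<or> i = 2" "j = 0 \<or> j = 1 \<or> j = 2" by auto
        moreover have "A $$ (2,2) = t - A $$ (0,0) - A $$ (1,1)" "B $$ (2,2) = t - B $$ (0,0) - B $$ (1,1)"
          using co[OF A] co[OF B] by blast+
        ultimately show "A $$ (i, j) = B $$ (i, j)" using eq by auto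
      qed (use A B in \<open>auto simp: int_mats_def\<close>)
    qed
  qed
  then have "R_count 3 H f \<le> 76 * m ^ 4 * T ^ 4" unfolding R_count_def by (rule card_le_if_at_most)
  then have "real (R_count 3 H f) \<le> real (76 * m ^ 4 * T ^ 4)" by (rule of_nat_mono)
  also have "\<dots> = 76 * real m ^ 4 * real T ^ 4" by simp
  also have "\<dots> \<le> 76 * (3 * H) ^ 4 * real T ^ 4"
  proof (intro mult_mono power_mono)
    have "real m = 2 * of_int \<lfloor>H\<rfloor> + 1" unfolding m_def using H by simp
    then show "real m \<le> 3 * H" using H of_int_floor_le[of H] by linarith
  qed (use H in auto)
  finally show ?thesis by (simp add: power_mult_distrib)
qed

text \<open>The estimate T \<le> C (256 H^6)^\<eta> gives T^4 at most a constant times H^(24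
  \<eta>). With \<eta> = \<epsilon> / 48 this uses half of \<epsilon>; the other half absorbs the
  constant \<open>C'\<close> as soon as H \<ge> C'^(2/\<epsilon>).\<close>

lemma admissible_if_R_count_le:
  assumes K: "K \<ge> 1" and j: "(real n)\<^sup>2 - real n - \<gamma> = real j"
    and R: "\<And>H T f. H \<ge> 1 \<Longrightarrow> divisor_bound T (256 * \<lfloor>H\<rfloor> ^ 6) \<Longrightarrow>
      real (R_count n H f) \<le> K * H ^ j * real T ^ 4"
  shows "admissible n \<gamma>"
  unfolding admissible_def j
proof (intro allI impI)
  fix \<epsilon> :: real assume e: "\<epsilon> > 0"
  define \<eta> where "\<eta> = \<epsilon> / 48"
  have eta: "\<eta> > 0" using e by (simp add: \<eta>_def)
  obtain C where C: "C \<ge> 1"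
    and D: "\<And>M. M \<ge> 1 \<Longrightarrow> \<exists>T. divisor_bound T M \<and> real T \<le> C * real_of_int M powr \<eta>"
    using divisor_bound_powr[OF eta] by blast
  define C' where "C' = K * (C * 256 powr \<eta>) ^ 4"
  have C'1: "C' \<ge> 1"
  proof -
    have "1 \<le> C * 256 powr \<eta>" using C eta mult_mono[of 1 C 1 "256 powr \<eta>"] by (simp add: ge_one_powr_ge_zero)
    then have "1 \<le> (C * 256 powr \<eta>) ^ 4" by (rule one_le_power)
    then show ?thesis using K mult_mono[of 1 K 1 "(C * 256 powr \<eta>) ^ 4"] by (simp add: C'_def)
  qed
  define H0 where "H0 = C' powr (2 / \<epsilon>)"
  have H0: "H0 \<ge> 1" unfolding H0_def using C'1 e by (intro ge_one_powr_ge_zero) auto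
  have "real (R_count n H f) \<le> H powr (real j + \<epsilon>)" if H: "H \<ge> H0" for H and f :: "int poly"
  proof -
    have H1: "H \<ge> 1" using H H0 by linarith
    then have "\<lfloor>H\<rfloor> \<ge> 1" by simp
    then have "\<lfloor>H\<rfloor> ^ 6 \<ge> 1" by (rule one_le_power)
    then have "256 * \<lfloor>H\<rfloor> ^ 6 \<ge> 1" by simp
    then obtain T where T: "divisor_bound T (256 * \<lfloor>H\<rfloor> ^ 6)"
      "real T \<le> C * real_of_int (256 * \<lfloor>H\<rfloor> ^ 6) powr \<eta>" using D by blast
    have "real_of_int (256 * \<lfloor>H\<rfloor> ^ 6) \<le> 256 * H ^ 6"
      using \<open>\<lfloor>H\<rfloor> \<ge> 1\<close> of_int_floor_le[of H] by (simp add: power_mono)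
    then have "real_of_int (256 * \<lfloor>H\<rfloor> ^ 6) powr \<eta> \<le> (256 * H ^ 6) powr \<eta>"
      using eta \<open>\<lfloor>H\<rfloor> \<ge> 1\<close> by (intro powr_mono2) auto
    also have "\<dots> = 256 powr \<eta> * (H powr 6) powr \<eta>" using H1 by (simp add: powr_mult)
    also have "(H powr 6) powr \<eta> = H powr (6 * \<eta>)" by (rule powr_powr)
    finally have "real T \<le> C * (256 powr \<eta> * H powr (6 * \<eta>))"
      using T(2) C mult_left_mono[of _ _ C] by (meson order_trans zero_le_one)
    then have "real T ^ 4 \<le> (C * 256 powr \<eta> * H powr (6 * \<eta>)) ^ 4" by (intro power_mono) (simp_all add: mult.assoc)
    also have "\<dots> = (C * 256 powr \<eta>) ^ 4 * (H powr (6 * \<eta>)) ^ 4" by (rule power_mult_distrib)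
    also have "(H powr (6 * \<eta>)) ^ 4 = H powr (\<epsilon> / 2)"
      using H1 by (subst powr_power) (simp_all add: \<eta>_def)
    finally have T4: "real T ^ 4 \<le> (C * 256 powr \<eta>) ^ 4 * H powr (\<epsilon> / 2)" .
    have "C' = H0 powr (\<epsilon> / 2)" unfolding H0_def using e C'1 by (simp add: powr_powr)
    also have "\<dots> \<le> H powr (\<epsilon> / 2)" using e H H0 by (intro powr_mono2) auto
    finally have C'H: "C' \<le> H powr (\<epsilon> / 2)" .
    have "real (R_count n H f) \<le> K * H ^ j * real T ^ 4" by (rule R[OF H1 T(1)])
    also have "\<dots> \<le> K * H ^ j * ((C * 256 powr \<eta>) ^ 4 * H powr (\<epsilon> / 2))"
      using T4 K H1 by (intro mult_left_mono) auto
    also have "\<dots> = C' * (H ^ j * H powr (\<epsilon> / 2))" by (simp add: C'_def)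
    also have "\<dots> \<le> H powr (\<epsilon> / 2) * (H ^ j * H powr (\<epsilon> / 2))"
      using C'H H1 by (intro mult_right_mono) auto
    also have "\<dots> = H powr real j * (H powr (\<epsilon> / 2) * H powr (\<epsilon> / 2))"
      using H1 by (simp add: powr_realpow)
    also have "\<dots> = H powr (real j + \<epsilon>)" by (simp flip: powr_add)
    finally show ?thesis .
  qed
  then show "\<exists>H0\<ge>1. \<forall>H\<ge>H0. \<forall>f :: int poly. degree f = n \<and> monic f \<longrightarrow>
      real (R_count n H f) \<le> H powr (real j + \<epsilon>)" using H0 by blast
qed

lemma R_count_2_square_ge:
  assumes H: "H \<ge> 1"
  shows "H \<le> real (R_count 2 H [:0, 0, 1:])"
proof -
  let ?N = "\<lambda>b::int. mat 2 2 (\<lambda>(i, j). if i = 0 \<and> j = 1 then b else 0)"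
  have "card {- \<lfloor>H\<rfloor>..\<lfloor>H\<rfloor>} \<le> R_count 2 H [:0, 0, 1:]" unfolding R_count_def
  proof (rule card_inj_on_le[where f = ?N])
    show "inj_on ?N {- \<lfloor>H\<rfloor>..\<lfloor>H\<rfloor>}"
    proof (rule inj_onI)
      fix b b' assume "?N b = ?N b'"
      then have "?N b $$ (0, 1) = ?N b' $$ (0, 1)" by simp
      then show "b = b'" by simp
    qed
    show "?N ` {- \<lfloor>H\<rfloor>..\<lfloor>H\<rfloor>} \<subseteq> {A \<in> int_mats 2 H. char_poly A = [:0, 0, 1:]}"
    proof (rule image_subsetI)
      fix b assume "b \<in> {- \<lfloor>H\<rfloor>..\<lfloor>H\<rfloor>}"
      then have "\<bar>b\<bar> \<le> \<lfloor>H\<rfloor>" by auto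
      then have "real_of_int \<bar>b\<bar> \<le> H" by (simp add: le_floor_iff)
      then have "?N b \<in> int_mats 2 H" using H by (auto simp: int_mats_def)
      moreover have "char_poly (?N b) = [:0, 0, 1:]" by (subst char_poly_2) auto
      ultimately show "?N b \<in> {A \<in> int_mats 2 H. char_poly A = [:0, 0, 1:]}" by simp
    qed
    show "finite {A \<in> int_mats 2 H. char_poly A = [:0, 0, 1:]}" using finite_int_mats by simp
  qed
  then have "real (nat (2 * \<lfloor>H\<rfloor> + 1)) \<le> real (R_count 2 H [:0, 0, 1:])" by simp
  moreover have "H \<le> real (nat (2 * \<lfloor>H\<rfloor> + 1))" using H by linarith
  ultimately show ?thesis by linarith
qed

lemma admissible_2_le:
  assumes "admissible 2 \<gamma>"
  shows "\<gamma> \<le> 1"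
proof (rule ccontr)
  assume "\<not> \<gamma> \<le> 1"
  \<comment> \<open>Half of the excess of \<gamma> over 1 makes the exponent 1 - \<epsilon>, still
    below the exponent 1 reached by X^2.\<close>
  define \<epsilon> where "\<epsilon> = (\<gamma> - 1) / 2"
  have e: "\<epsilon> > 0" using \<open>\<not> \<gamma> \<le> 1\<close> by (simp add: \<epsilon>_def)
  have ex: "(real 2)\<^sup>2 - real 2 - \<gamma> + \<epsilon> = 1 - \<epsilon>" by (simp add: \<epsilon>_def field_simps)
  obtain H0 where H0: "H0 \<ge> 1" "\<And>H f. H \<ge> H0 \<Longrightarrow> degree f = 2 \<Longrightarrow> monic f \<Longrightarrow>
      real (R_count 2 H f) \<le> H powr (1 - \<epsilon>)"
    using assms e unfolding admissible_def ex[symmetric] by blast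
  define H where "H = H0 + 1"
  have H: "H > 1" "H \<ge> H0" using H0(1) by (auto simp: H_def)
  have "H \<le> real (R_count 2 H [:0, 0, 1:])" using H by (intro R_count_2_square_ge) simp
  also have "\<dots> \<le> H powr (1 - \<epsilon>)" using H by (intro H0(2)) auto
  also have "\<dots> < H powr 1" using H e by (intro powr_less_mono) auto
  finally show False using H by simp
qed

theorem theorem2p1:
  shows "gamma 2 = 1 \<and> gamma 3 \<ge> 2"
proof
  have "admissible 2 1"
    by (rule admissible_if_R_count_le[OF _ _ R_count_2_le]) auto
  then show "gamma 2 = 1"
    using gamma_greatest[of 2] admissible_2_le by (meson order_antisym)
  have "admissible 3 2"
    by (rule admissible_if_R_count_le[OF _ _ R_count_3_le]) auto
  then show "gamma 3 \<ge> 2" using gamma_greatest by blast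
qed

end
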